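(* Let $G$ be any compact group and let $\Psi$ be any (nonempty) list of frequencies, with $D=\sum_{\rho\in\Psi}\beta_\rho d_\rho^2$. If $0\le\lambda<1/\sqrt D$, then $\mathrm{GSynch}_n(\lambda,G,\Psi)$ is contiguous to $\mathrm{GSynch}_n(0,G,\Psi)$.
   Context: Representations. Every irreducible complex representation $\rho$ of a compact group $G$ is finite dimensional, may be taken unitary, and has real, complex, or quaternionic type. Real-type representations are taken to be defined by unitary matrices over $\mathbb{R}$, complex-type over $\mathbb{C}$, and quaternionic-type over the quaternions $\mathbb{H}$ (via the standard embedding of $\mathbb{H}$ into $2\times2$ complex matrices). $d_\rho$ is the dimension of $\rho$ over $\mathbb{R},\mathbb{C},\mathbb{H}$ respectively (so for quaternionic type $d_\rho$ is half the complex dimension), and $\beta_\rho=1,2,4$ respectively. A list of frequencies $\Psi$ is a finite set of pairwise non-isomorphic irreducible (over $\mathbb{C}$) representations of $G$, not containing the trivial representation, and not containing both $\rho$ and its conjugate $\bar\rho$ for any complex-type $\rho$. Noise. A standard Gaussian of real, complex, quaternionic type is $\mathcal{N}(0,1)$; $\mathcal{N}(0,\frac12)+\mathcal{N}(0,\frac12)i$; $\mathcal{N}(0,\frac14)+\mathcal{N}(0,\frac14)i+\mathcal{N}(0,\frac14)j+\mathcal{N}(0,\frac14)k$, respectively, with independent components. A GOE, GUE, GSE matrix is a random Hermitian matrix over $\mathbb{R},\mathbb{C},\mathbb{H}$ respectively, with off-diagonal entries standard Gaussians of the corresponding type and diagonal entries real $\mathcal{N}(0,2/\beta)$, $\beta=1,2,4$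 respectively, independent except for the Hermitian constraint. Model. $\mathrm{GSynch}_n(\{\lambda_\rho\},G,\Psi)$, with $\lambda_\rho\ge0$ for $\rho\in\Psi$: draw $g\in G^n$ with independent Haar-distributed coordinates. Let $X_\rho$ be the $nd_\rho\times d_\rho$ matrix obtained by stacking the matrices $\rho(g_u)$, $u=1,\dots,n$. For each $\rho\in\Psi$ reveal the $nd_\rho\times nd_\rho$ matrix $Y_\rho=\frac{\lambda_\rho}nX_\rho X_\rho^*+\frac1{\sqrt{nd_\rho}}W_\rho$, where $W_\rho$ is a GOE, GUE or GSE matrix according to the type of $\rho$; the $W_\rho$ are independent across $\rho$ and independent of $g$. The model is the joint law of $\{Y_\rho\}_{\rho\in\Psi}$. A scalar $\lambda$ in place of $\{\lambda_\rho\}$ means $\lambda_\rho=\lambda$ for all $\rho$. Contiguity: for sequences of probability measures $P_n,Q_n$ on measurable spaces $(\Omega_n,\mathcal{F}_n)$, $P_n$ is contiguous to $Q_n$ if for every sequence of events $A_n\in\mathcal{F}_n$, $Q_n(A_n)\to0$ implies $P_n(A_n)\to0$ as $n\to\infty$. *)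

theory Defs
  imports "HOL-Probability.Probability" "Jordan_Normal_Form.Schur_Decomposition"
    "Jordan_Normal_Form.VS_Connect"
begin

text \<open>
  A compact group is a type of class \<^class>\<open>topological_group_add\<close> (not assumed commutative,
  but written additively), Hausdorff, with compact \<^const>\<open>UNIV\<close>. Its Haar probability measure is the
  unique regular left-invariant Borel probability measure; regularity is needed for uniqueness
  when the topology is not second countable.
\<close>

definition haar_probability :: "'g::{topological_group_add,t2_space} measure \<Rightarrow> bool" where
  "haar_probability \<mu> \<longleftrightarrow>
     sets \<mu> = sets borel \<and> prob_space \<mu> \<and>
     (\<forall>g. distr \<mu> \<mu> (\<lambda>x. g + x) = \<mu>) \<and>
     (\<forall>A\<in>sets \<mu>. emeasure \<mu> A = (INF U\<in>{U. open U \<and> A \<subseteq> U}. emeasure \<mu> U)) \<and>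
     (\<forall>A\<in>sets \<mu>. emeasure \<mu> A = (SUP K\<in>{K. compact K \<and> K \<subseteq> A}. emeasure \<mu> K))"


section \<open>Matrices over the reals, the complex numbers and the quaternions\<close>

datatype field_type = Real_type | Complex_type | Quaternionic_type

fun beta :: "field_type \<Rightarrow> nat" where
  "beta Real_type = 1"
| "beta Complex_type = 2"
| "beta Quaternionic_type = 4"

text \<open>
  All matrices are represented over the complex numbers: a \<open>d \<times> d\<close> matrix over the scalars of
  type \<open>t\<close> is a complex matrix of size \<open>blk t * d\<close>, each scalar becoming a square block of size
  \<open>blk t\<close>. The quaternion \<open>x0 + x1 i + x2 j + x3 k\<close> becomes the usual \<open>2 \<times> 2\<close> matrix. Under this
  injective *-homomorphism, products, conjugate transposes and real multiples of quaternionic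
  matrices are those of their complex representatives.
\<close>

fun blk :: "field_type \<Rightarrow> nat" where
  "blk Real_type = 1"
| "blk Complex_type = 1"
| "blk Quaternionic_type = 2"

fun scalar_block :: "field_type \<Rightarrow> (nat \<Rightarrow> real) \<Rightarrow> complex mat" where
  "scalar_block Real_type x = mat_of_rows_list 1 [[Complex (x 0) 0]]"
| "scalar_block Complex_type x = mat_of_rows_list 1 [[Complex (x 0) (x 1)]]"
| "scalar_block Quaternionic_type x = mat_of_rows_list 2
     [[Complex (x 0) (x 1), Complex (x 2) (x 3)],
      [Complex (- x 2) (x 3), Complex (x 0) (- x 1)]]"

definition matrix_over :: "field_type \<Rightarrow> nat \<Rightarrow> complex mat \<Rightarrow> bool" where
  "matrix_over t d M \<longleftrightarrow> M \<in> carrier_mat (blk t * d) (blk t * d) \<and>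
     (\<forall>i<d. \<forall>j<d. \<exists>x. \<forall>a<blk t. \<forall>b<blk t.
        M $$ (blk t * i + a, blk t * j + b) = scalar_block t x $$ (a, b))"


section \<open>Representations and lists of frequencies\<close>

definition unitary_rep :: "nat \<Rightarrow> ('g::topological_group_add \<Rightarrow> complex mat) \<Rightarrow> bool" where
  "unitary_rep m R \<longleftrightarrow>
     (\<forall>g. R g \<in> carrier_mat m m \<and> R g * mat_adjoint (R g) = 1\<^sub>m m) \<and>
     (\<forall>g h. R (g + h) = R g * R h) \<and>
     (\<forall>i<m. \<forall>j<m. continuous_on UNIV (\<lambda>g. R g $$ (i, j)))"

definition irreducible_rep :: "nat \<Rightarrow> ('g \<Rightarrow> complex mat) \<Rightarrow> bool" where
  "irreducible_rep m R \<longleftrightarrow> m > 0 \<and>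
     (\<forall>V. subspace class_ring V (module_vec TYPE(complex) m) \<longrightarrow>
        (\<forall>g. \<forall>v\<in>V. R g *\<^sub>v v \<in> V) \<longrightarrow> V = {0\<^sub>v m} \<or> V = carrier_vec m)"

definition isomorphic_reps ::
    "nat \<Rightarrow> ('g \<Rightarrow> complex mat) \<Rightarrow> nat \<Rightarrow> ('g \<Rightarrow> complex mat) \<Rightarrow> bool" where
  "isomorphic_reps m R m' R' \<longleftrightarrow> m = m' \<and>
     (\<exists>T\<in>carrier_mat m m. invertible_mat T \<and> (\<forall>g. T * R g = R' g * T))"

definition conj_rep :: "('g \<Rightarrow> complex mat) \<Rightarrow> 'g \<Rightarrow> complex mat" where
  "conj_rep R g = map_mat cnj (R g)"

datatype 'g frequency =
  Frequency (ftype: field_type) (fdim: nat) (frep: "'g \<Rightarrow> complex mat")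

definition cdim :: "'g frequency \<Rightarrow> nat" where
  "cdim \<rho> = blk (ftype \<rho>) * fdim \<rho>"

text \<open>
  An irreducible representation by matrices over the reals (quaternions) is automatically of
  real (quaternionic) type; a complex one is of complex type iff it is not isomorphic to its
  conjugate.
\<close>

definition is_frequency :: "'g::topological_group_add frequency \<Rightarrow> bool" where
  "is_frequency \<rho> \<longleftrightarrow>
     (\<forall>g. matrix_over (ftype \<rho>) (fdim \<rho>) (frep \<rho> g)) \<and>
     unitary_rep (cdim \<rho>) (frep \<rho>) \<and>
     irreducible_rep (cdim \<rho>) (frep \<rho>) \<and>
     (ftype \<rho> = Complex_type \<longrightarrow>
        \<not> isomorphic_reps (cdim \<rho>) (frep \<rho>) (cdim \<rho>) (conj_rep (frep \<rho>)))"

definition list_of_frequencies :: "'g::topological_group_add frequency set \<Rightarrow> bool" where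
  "list_of_frequencies \<Psi> \<longleftrightarrow> finite \<Psi> \<and>
     (\<forall>\<rho>\<in>\<Psi>. is_frequency \<rho>) \<and>
     (\<forall>\<rho>\<in>\<Psi>. \<not> isomorphic_reps (cdim \<rho>) (frep \<rho>) 1 (\<lambda>g. 1\<^sub>m 1)) \<and>
     (\<forall>\<rho>\<in>\<Psi>. \<forall>\<sigma>\<in>\<Psi>. \<rho> \<noteq> \<sigma> \<longrightarrow>
        \<not> isomorphic_reps (cdim \<rho>) (frep \<rho>) (cdim \<sigma>) (frep \<sigma>)) \<and>
     (\<forall>\<rho>\<in>\<Psi>. \<forall>\<sigma>\<in>\<Psi>. ftype \<rho> = Complex_type \<longrightarrow>
        \<not> isomorphic_reps (cdim \<sigma>) (frep \<sigma>) (cdim \<rho>) (conj_rep (frep \<rho>)))"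


section \<open>Random matrices\<close>

text \<open>The \<open>N \<times> N\<close> complex matrices with the Borel \<open>\<sigma>\<close>-algebra, generated by the entries.\<close>

definition matrix_space :: "nat \<Rightarrow> complex mat measure" where
  "matrix_space N = vimage_algebra (carrier_mat N N)
     (\<lambda>M. \<lambda>p\<in>{..<N} \<times> {..<N}. M $$ p) (PiM ({..<N} \<times> {..<N}) (\<lambda>_. borel))"

text \<open>
  Here \<open>z (i, j, k)\<close> is a family of independent real standard Gaussians. Component \<open>k\<close> of entry
  \<open>(i, j)\<close>, \<open>i < j\<close>, is \<open>z (i, j, k) / sqrt \<beta>\<close>; the diagonal entry is \<open>sqrt (2 / \<beta>) * z (i, i, 0)\<close>;
  entries below the diagonal are given by the Hermitian constraint.
\<close>

definition hermitian_of_gaussians ::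
    "field_type \<Rightarrow> nat \<Rightarrow> (nat \<times> nat \<times> nat \<Rightarrow> real) \<Rightarrow> complex mat" where
  "hermitian_of_gaussians t N z =
     Matrix.mat (blk t * N) (blk t * N) (\<lambda>(p, q).
       let s = blk t; i = p div s; a = p mod s; j = q div s; b = q mod s in
       if i < j then scalar_block t (\<lambda>k. z (i, j, k) / sqrt (real (beta t))) $$ (a, b)
       else if i = j then
         scalar_block t (\<lambda>k. if k = 0 then sqrt (2 / real (beta t)) * z (i, i, 0) else 0) $$ (a, b)
       else cnj (scalar_block t (\<lambda>k. z (j, i, k) / sqrt (real (beta t))) $$ (b, a)))"

text \<open>The law of a GOE, GUE or GSE matrix of size \<open>N\<close>, according to the type.\<close>

definition gaussian_ensemble :: "field_type \<Rightarrow> nat \<Rightarrow> complex mat measure" where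
  "gaussian_ensemble t N =
     distr (PiM ({..<N} \<times> {..<N} \<times> {..<beta t}) (\<lambda>_. std_normal_distribution))
       (matrix_space (blk t * N)) (hermitian_of_gaussians t N)"


section \<open>The Gaussian synchronization model\<close>

definition stacked :: "nat \<Rightarrow> 'g frequency \<Rightarrow> (nat \<Rightarrow> 'g) \<Rightarrow> complex mat" where
  "stacked n \<rho> g = Matrix.mat (n * cdim \<rho>) (cdim \<rho>)
     (\<lambda>(p, q). frep \<rho> (g (p div cdim \<rho>)) $$ (p mod cdim \<rho>, q))"

definition observation ::
    "nat \<Rightarrow> real \<Rightarrow> 'g frequency \<Rightarrow> (nat \<Rightarrow> 'g) \<Rightarrow> complex mat \<Rightarrow> complex mat" where
  "observation n l \<rho> g W =
     of_real (l / real n) \<cdot>\<^sub>m (stacked n \<rho> g * mat_adjoint (stacked n \<rho> g)) +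
     of_real (1 / sqrt (real (n * fdim \<rho>))) \<cdot>\<^sub>m W"

definition GSynch ::
    "nat \<Rightarrow> ('g frequency \<Rightarrow> real) \<Rightarrow> 'g measure \<Rightarrow> 'g frequency set \<Rightarrow>
      ('g frequency \<Rightarrow> complex mat) measure" where
  "GSynch n lam \<mu> \<Psi> =
     distr (PiM {..<n} (\<lambda>_. \<mu>) \<Otimes>\<^sub>M PiM \<Psi> (\<lambda>\<rho>. gaussian_ensemble (ftype \<rho>) (n * fdim \<rho>)))
       (PiM \<Psi> (\<lambda>\<rho>. matrix_space (n * cdim \<rho>)))
       (\<lambda>(g, W). \<lambda>\<rho>\<in>\<Psi>. observation n (lam \<rho>) \<rho> g (W \<rho>))"


section \<open>Contiguity\<close>

definition contiguous :: "(nat \<Rightarrow> 'a measure) \<Rightarrow> (nat \<Rightarrow> 'a measure) \<Rightarrow> bool" where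
  "contiguous P Q \<longleftrightarrow>
     (\<forall>n. prob_space (P n) \<and> prob_space (Q n) \<and> sets (P n) = sets (Q n)) \<and>
     (\<forall>A. (\<forall>n. A n \<in> sets (Q n)) \<longrightarrow> (\<lambda>n. measure (Q n) (A n)) \<longlonglongrightarrow> 0 \<longrightarrow>
        (\<lambda>n. measure (P n) (A n)) \<longlonglongrightarrow> 0)"

end

theory Submission
  imports Defs
begin

text \<open>
  The second moment method applies directly. The observation is the image, under a map that does not
  depend on \<open>\<lambda>\<close>, of a standard Gaussian vector shifted by a mean \<open>m(g)\<close>; the likelihood ratio
  \<open>L\<close> of the shifted vector satisfies \<open>E L\<^sup>2 = E exp \<langle>m(g), m(g')\<rangle>\<close> for independent \<open>g\<close>, \<open>g'\<close>. With
  \<open>V\<^sub>u = \<rho>(g\<^sub>u)\<^sup>* \<rho>(g'\<^sub>u)\<close> the exponent is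
  \<open>(\<lambda>\<^sup>2 / 2n) \<Sum>\<^sub>\<rho> \<beta>\<^sub>\<rho> d\<^sub>\<rho> \<parallel>\<Sum>\<^sub>u V\<^sub>u\<parallel>\<^sup>2\<close>, the squared norm of a sum of \<open>n\<close> independent vectors in
  \<open>\<real>\<^sup>D\<close>. Given \<open>g\<close>, these are centred, because the mean of a nontrivial irreducible representation
  is an invariant operator and hence zero, and they have squared norm \<open>D\<close>. By Hoeffding's lemma they are
  sub-Gaussian with variance proxy \<open>D\<close>, which bounds \<open>E L\<^sup>2\<close> by \<open>(1 - \<lambda>\<^sup>2 D)\<^bsup>-D/2\<^esup>\<close> uniformly in \<open>n\<close>.

  Conditioning on \<open>g\<close>, instead of passing to \<open>g\<^sub>u\<^sup>-\<^sup>1 g'\<^sub>u\<close>, avoids the group operation on pairs, which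
  need not be measurable for the product \<open>\<sigma>\<close>-algebra when the topology is not second countable.
\<close>

section \<open>Products of measures\<close>

text \<open>A finite product measure is determined by its values on boxes, and the preimage of a box
  under a componentwise map is again a box. The hypotheses range over all indices because
  \<open>product_prob_space\<close> concerns a family over the whole index type.\<close>

lemma distr_PiM_componentwise:
  assumes "finite I" and M: "\<And>i. prob_space (M i)"
    and f[measurable]: "\<And>i. f i \<in> M i \<rightarrow>\<^sub>M N i"
  shows "distr (PiM I M) (PiM I N) (\<lambda>x. \<lambda>i\<in>I. f i (x i)) = PiM I (\<lambda>i. distr (M i) (N i) (f i))"
proof -
  interpret M: product_prob_space M by (rule product_prob_spaceI) (rule M)
  interpret D: product_prob_space "\<lambda>i. distr (M i) (N i) (f i)"
    by (rule product_prob_spaceI) (intro prob_space.prob_space_distr M f)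
  show ?thesis
  proof (rule D.PiM_eqI[OF \<open>finite I\<close>])
    fix A assume A: "\<And>i. i \<in> I \<Longrightarrow> A i \<in> sets (distr (M i) (N i) (f i))"
    have eq: "(\<lambda>x. \<lambda>i\<in>I. f i (x i)) -` Pi\<^sub>E I A \<inter> space (PiM I M)
        = (\<Pi>\<^sub>E i\<in>I. f i -` A i \<inter> space (M i))"
      by (auto simp: space_PiM PiE_iff extensional_def)
    have "emeasure (distr (PiM I M) (PiM I N) (\<lambda>x. \<lambda>i\<in>I. f i (x i))) (Pi\<^sub>E I A)
        = emeasure (PiM I M) (\<Pi>\<^sub>E i\<in>I. f i -` A i \<inter> space (M i))"
      using A \<open>finite I\<close> by (subst emeasure_distr) (auto simp: eq intro!: sets_PiM_I_finite)
    also have "\<dots> = (\<Prod>i\<in>I. emeasure (M i) (f i -` A i \<inter> space (M i)))"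
      using A by (intro M.emeasure_PiM \<open>finite I\<close>) (auto intro: measurable_sets[OF f])
    also have "\<dots> = (\<Prod>i\<in>I. emeasure (distr (M i) (N i) (f i)) (A i))"
      using A by (intro prod.cong refl) (simp add: emeasure_distr)
    finally show "emeasure (distr (PiM I M) (PiM I N) (\<lambda>x. \<lambda>i\<in>I. f i (x i))) (Pi\<^sub>E I A) = \<dots>" .
  qed (auto intro!: sets_PiM_cong)
qed

text \<open>Checked on boxes as well: the indicator of a box is a product over the coordinates, so
  the integral splits into one factor per coordinate.\<close>

lemma density_PiM:
  assumes "finite I" and M: "\<And>i. prob_space (M i)"
    and f[measurable]: "\<And>i. f i \<in> borel_measurable (M i)"
    and d: "\<And>i. prob_space (density (M i) (f i))"
  shows "density (PiM I M) (\<lambda>x. \<Prod>i\<in>I. f i (x i)) = PiM I (\<lambda>i. density (M i) (f i))"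
proof -
  interpret M: product_prob_space M by (rule product_prob_spaceI) (rule M)
  interpret D: product_prob_space "\<lambda>i. density (M i) (f i)"
    by (rule product_prob_spaceI) (rule d)
  show ?thesis
  proof (rule D.PiM_eqI[OF \<open>finite I\<close>])
    fix A assume A: "\<And>i. i \<in> I \<Longrightarrow> A i \<in> sets (density (M i) (f i))"
    have "emeasure (density (PiM I M) (\<lambda>x. \<Prod>i\<in>I. f i (x i))) (Pi\<^sub>E I A)
        = (\<integral>\<^sup>+x. (\<Prod>i\<in>I. f i (x i)) * indicator (Pi\<^sub>E I A) x \<partial>PiM I M)"
      using A \<open>finite I\<close> by (subst emeasure_density) (auto intro!: sets_PiM_I_finite)
    also have "\<dots> = (\<integral>\<^sup>+x. (\<Prod>i\<in>I. f i (x i) * indicator (A i) (x i)) \<partial>PiM I M)"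
    proof (intro nn_integral_cong)
      fix x assume "x \<in> space (PiM I M)"
      then have "indicator (Pi\<^sub>E I A) x = (\<Prod>i\<in>I. indicator (A i) (x i) :: ennreal)"
        using \<open>finite I\<close>
        by (cases "x \<in> Pi\<^sub>E I A") (auto simp: space_PiM PiE_iff indicator_def intro!: prod_zero)
      then show "(\<Prod>i\<in>I. f i (x i)) * indicator (Pi\<^sub>E I A) x
          = (\<Prod>i\<in>I. f i (x i) * indicator (A i) (x i))"
        by (simp add: prod.distrib)
    qed
    also have "\<dots> = (\<Prod>i\<in>I. \<integral>\<^sup>+x. f i x * indicator (A i) x \<partial>M i)"
      by (rule M.product_nn_integral_prod) (use A \<open>finite I\<close> in auto)
    also have "\<dots> = (\<Prod>i\<in>I. emeasure (density (M i) (f i)) (A i))"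
      using A by (intro prod.cong refl) (simp add: emeasure_density)
    finally show "emeasure (density (PiM I M) (\<lambda>x. \<Prod>i\<in>I. f i (x i))) (Pi\<^sub>E I A) = \<dots>" .
  qed (auto intro!: sets_PiM_cong)
qed

lemma distr_PiM_eq_density:
  assumes "finite I" and M: "\<And>i. prob_space (M i)"
    and f: "\<And>i. f i \<in> borel_measurable (M i)"
    and T: "\<And>i. T i \<in> M i \<rightarrow>\<^sub>M M i"
    and eq: "\<And>i. distr (M i) (M i) (T i) = density (M i) (f i)"
  shows "distr (PiM I M) (PiM I M) (\<lambda>x. \<lambda>i\<in>I. T i (x i))
    = density (PiM I M) (\<lambda>x. \<Prod>i\<in>I. f i (x i))"
proof -
  have "prob_space (density (M i) (f i))" for i
    using prob_space.prob_space_distr[OF M T] by (simp add: eq)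
  then show ?thesis
    using assms by (simp add: distr_PiM_componentwise density_PiM)
qed

section \<open>Gaussian integrals\<close>

abbreviation "\<gamma> \<equiv> std_normal_distribution"

lemma prob_space_gamma: "prob_space \<gamma>"
  using prob_space_normal_density[of 1 0] by simp

text \<open>The density of the normal law with mean \<open>m\<close> and variance 1 relative to the
  standard normal law.\<close>

definition shift_density :: "real \<Rightarrow> real \<Rightarrow> real" where
  "shift_density m x = exp (m * x - m\<^sup>2 / 2)"

lemma shift_density_measurable[measurable]:
  "(\<lambda>x. shift_density (f x) (g x)) \<in> borel_measurable M"
  if [measurable]: "f \<in> borel_measurable M" "g \<in> borel_measurable M"
  unfolding shift_density_def by measurable

text \<open>Translation invariance of Lebesgue measure moves the shift from the event to the
  density; expanding the square then splits off the relative density.\<close>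

lemma distr_gamma_shift: "distr \<gamma> \<gamma> (\<lambda>x. x + m) = density \<gamma> (shift_density m)"
proof (rule measure_eqI)
  fix A assume "A \<in> sets (distr \<gamma> \<gamma> (\<lambda>x. x + m))"
  then have A[measurable]: "A \<in> sets borel" by simp
  have "emeasure (distr \<gamma> \<gamma> (\<lambda>x. x + m)) A = (\<integral>\<^sup>+x. indicator A (x + m) \<partial>\<gamma>)"
    by (simp add: nn_integral_distr flip: nn_integral_indicator)
  also have "\<dots> = (\<integral>\<^sup>+x. ennreal (std_normal_density x) * indicator A (x + m) \<partial>lborel)"
    by (simp add: nn_integral_density)
  also have "\<dots> = (\<integral>\<^sup>+x. ennreal (std_normal_density (x - m)) * indicator A x \<partial>lborel)"
    by (subst nn_integral_real_affine[where c=1 and t="-m"]) auto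
  also have "\<dots> = (\<integral>\<^sup>+x. ennreal (std_normal_density x) *
      (ennreal (shift_density m x) * indicator A x) \<partial>lborel)"
  proof (intro nn_integral_cong)
    fix x
    have "std_normal_density (x - m) = std_normal_density x * shift_density m x"
      by (simp add: std_normal_density_def shift_density_def flip: exp_add)
         (simp add: field_simps power2_eq_square)
    then show "ennreal (std_normal_density (x - m)) * indicator A x
        = ennreal (std_normal_density x) * (ennreal (shift_density m x) * indicator A x)"
      by (simp add: ennreal_mult shift_density_def mult.assoc)
  qed
  also have "\<dots> = emeasure (density \<gamma> (shift_density m)) A"
    by (simp add: emeasure_density nn_integral_density)
  finally show "emeasure (distr \<gamma> \<gamma> (\<lambda>x. x + m)) A = emeasure (density \<gamma> (shift_density m)) A" .
qed simp

lemma nn_integral_shift_density: "(\<integral>\<^sup>+x. shift_density m x \<partial>\<gamma>) = 1"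
proof -
  interpret prob_space "distr \<gamma> \<gamma> (\<lambda>x. x + m)"
    by (rule prob_space.prob_space_distr[OF prob_space_gamma]) simp
  show ?thesis
    using emeasure_space_1 by (simp add: distr_gamma_shift emeasure_density)
qed

lemma nn_integral_exp_gamma: "(\<integral>\<^sup>+x. exp (s * x) \<partial>\<gamma>) = exp (s\<^sup>2 / 2)"
proof -
  have "ennreal (exp (s * x)) = ennreal (exp (s\<^sup>2 / 2)) * ennreal (shift_density s x)" for x
    by (simp add: shift_density_def flip: exp_add ennreal_mult)
  then show ?thesis
    by (simp add: nn_integral_cmult nn_integral_shift_density)
qed

text \<open>The quadratic terms of the two exponents differ from that of a shift by
  \<open>m + m'\<close> exactly by the cross term \<open>m * m'\<close>, and a shift density has
  total mass 1.\<close>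

lemma nn_integral_shift_density_mult:
  "(\<integral>\<^sup>+x. ennreal (shift_density m x) * ennreal (shift_density m' x) \<partial>\<gamma>) = exp (m * m')"
proof -
  have "shift_density m x * shift_density m' x = exp (m * m') * shift_density (m + m') x" for x
    by (simp add: shift_density_def flip: exp_add) (simp add: field_simps power2_eq_square)
  then have "(\<integral>\<^sup>+x. ennreal (shift_density m x) * ennreal (shift_density m' x) \<partial>\<gamma>)
      = (\<integral>\<^sup>+x. ennreal (exp (m * m')) * ennreal (shift_density (m + m') x) \<partial>\<gamma>)"
    by (intro nn_integral_cong)
       (simp add: ennreal_mult[symmetric] shift_density_def)
  then show ?thesis
    by (simp add: nn_integral_cmult nn_integral_shift_density)
qed

text \<open>The integrand times the standard normal density is \<open>s\<close> times a centred
  normal density with standard deviation \<open>s = 1 / sqrt (1 - a)\<close>.\<close>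

lemma nn_integral_exp_square_gamma:
  assumes "0 \<le> a" "a < 1"
  shows "(\<integral>\<^sup>+x. exp (a * x\<^sup>2 / 2) \<partial>\<gamma>) = 1 / sqrt (1 - a)"
proof -
  define s where "s = 1 / sqrt (1 - a)"
  have s: "s > 0" "s\<^sup>2 = 1 / (1 - a)" using assms by (auto simp: s_def power_divide)
  have eq: "std_normal_density x * exp (a * x\<^sup>2 / 2) = s * normal_density 0 s x" for x
  proof -
    have "sqrt (2 * pi * s\<^sup>2) = s * sqrt (2 * pi)"
      using s(1) by (simp add: real_sqrt_mult)
    moreover have "- x\<^sup>2 / 2 + a * x\<^sup>2 / 2 = - x\<^sup>2 / (2 * s\<^sup>2)"
      using assms by (simp add: s(2) field_simps)
    ultimately show ?thesis
      using s(1) by (simp add: normal_density_def flip: exp_add)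
  qed
  interpret prob_space "density lborel (normal_density 0 s)"
    by (rule prob_space_normal_density) (rule s)
  have 1: "(\<integral>\<^sup>+x. normal_density 0 s x \<partial>lborel) = 1"
    using emeasure_space_1 by (simp add: emeasure_density)
  have "(\<integral>\<^sup>+x. exp (a * x\<^sup>2 / 2) \<partial>\<gamma>)
      = (\<integral>\<^sup>+x. ennreal s * ennreal (normal_density 0 s x) \<partial>lborel)"
    using s(1) by (simp add: nn_integral_density eq flip: ennreal_mult)
  also have "\<dots> = s" by (simp add: nn_integral_cmult 1)
  finally show ?thesis by (simp add: s_def)
qed

section \<open>Shifts of Gaussian vectors and correlations of their likelihood ratios\<close>

lemma distr_gamma_PiM_shift:
  assumes "finite J"
  shows "distr (PiM J (\<lambda>_. \<gamma>)) (PiM J (\<lambda>_. \<gamma>)) (\<lambda>z. \<lambda>j\<in>J. z j + m j)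
    = density (PiM J (\<lambda>_. \<gamma>)) (\<lambda>z. \<Prod>j\<in>J. ennreal (shift_density (m j) (z j)))"
  using distr_PiM_eq_density[OF assms, of "\<lambda>_. \<gamma>" "\<lambda>j z. shift_density (m j) z" "\<lambda>j z. z + m j"]
  by (simp add: distr_gamma_shift prob_space_gamma)

lemma prob_space_gamma_PiM: "prob_space (PiM J (\<lambda>_. \<gamma>))"
  by (rule prob_space_PiM) (rule prob_space_gamma)

lemma nn_integral_PiM_shift_density_mult:
  assumes "finite J"
  shows "(\<integral>\<^sup>+z. (\<Prod>j\<in>J. ennreal (shift_density (m j) (z j))) *
      (\<Prod>j\<in>J. ennreal (shift_density (m' j) (z j))) \<partial>PiM J (\<lambda>_. \<gamma>)) = exp (\<Sum>j\<in>J. m j * m' j)"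
proof -
  interpret product_prob_space "\<lambda>_. \<gamma>" by (rule product_prob_spaceI) (rule prob_space_gamma)
  show ?thesis
    using assms unfolding prod.distrib[symmetric]
    by (subst product_nn_integral_prod)
       (auto simp: nn_integral_shift_density_mult exp_sum prod_ennreal)
qed

text \<open>The outer product will run over the frequencies and the inner one over the Gaussian
  coordinates of one noise matrix, whose number depends on the frequency; hence the nested form with
  index sets \<open>J i\<close>.\<close>

lemma distr_gamma_PiM_PiM_shift:
  assumes "finite I" and J: "\<And>i. finite (J i)"
  defines "Z \<equiv> PiM I (\<lambda>i. PiM (J i) (\<lambda>_. \<gamma>))"
  shows "distr Z Z (\<lambda>z. \<lambda>i\<in>I. \<lambda>j\<in>J i. z i j + m i j)
    = density Z (\<lambda>z. \<Prod>i\<in>I. \<Prod>j\<in>J i. ennreal (shift_density (m i j) (z i j)))"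
  unfolding Z_def
proof (rule distr_PiM_eq_density[OF \<open>finite I\<close>])
  show "(\<lambda>z. \<lambda>j\<in>J i. z j + m i j) \<in> PiM (J i) (\<lambda>_. \<gamma>) \<rightarrow>\<^sub>M PiM (J i) (\<lambda>_. \<gamma>)" for i
    by (rule measurable_restrict) simp
qed (simp_all add: distr_gamma_PiM_shift[simplified restrict_def] prob_space_gamma_PiM J restrict_def)

lemma nn_integral_PiM_PiM_shift_density_mult:
  assumes "finite I" and J: "\<And>i. finite (J i)"
  shows "(\<integral>\<^sup>+z. (\<Prod>i\<in>I. \<Prod>j\<in>J i. ennreal (shift_density (m i j) (z i j))) *
      (\<Prod>i\<in>I. \<Prod>j\<in>J i. ennreal (shift_density (m' i j) (z i j)))
      \<partial>PiM I (\<lambda>i. PiM (J i) (\<lambda>_. \<gamma>))) = exp (\<Sum>i\<in>I. \<Sum>j\<in>J i. m i j * m' i j)"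
proof -
  interpret product_prob_space "\<lambda>i. PiM (J i) (\<lambda>_. \<gamma>)"
    by (rule product_prob_spaceI) (rule prob_space_gamma_PiM)
  have "(\<integral>\<^sup>+z. (\<Prod>i\<in>I. (\<Prod>j\<in>J i. ennreal (shift_density (m i j) (z i j))) *
      (\<Prod>j\<in>J i. ennreal (shift_density (m' i j) (z i j))))
      \<partial>PiM I (\<lambda>i. PiM (J i) (\<lambda>_. \<gamma>)))
      = (\<Prod>i\<in>I. ennreal (exp (\<Sum>j\<in>J i. m i j * m' i j)))"
    by (subst product_nn_integral_prod) (use assms in \<open>simp_all add: nn_integral_PiM_shift_density_mult\<close>)
  then show ?thesis
    using assms by (simp add: prod.distrib exp_sum prod_ennreal prod_nonneg)
qed

section \<open>Sub-Gaussian sums\<close>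

text \<open>The square is linearised by integrating against an independent standard Gaussian vector;
  Hoeffding's lemma then applies to the linear functionals.\<close>

lemma nn_integral_exp_norm_sum_le:
  fixes v :: "nat \<Rightarrow> 'b \<Rightarrow> 'a \<Rightarrow> real"
  assumes M: "prob_space M" and "finite I"
    and v[measurable]: "\<And>u i. i \<in> I \<Longrightarrow> v u i \<in> borel_measurable M"
    and bound: "\<And>u x. u < n \<Longrightarrow> x \<in> space M \<Longrightarrow> (\<Sum>i\<in>I. (v u i x)\<^sup>2) \<le> D"
    and mean: "\<And>u i. u < n \<Longrightarrow> i \<in> I \<Longrightarrow> (\<integral>x. v u i x \<partial>M) = 0"
    and "0 \<le> a" "0 \<le> D" "a * D < 1" "n > 0"
  shows "(\<integral>\<^sup>+x. exp (a / (2 * n) * (\<Sum>i\<in>I. (\<Sum>u<n. v u i (x u))\<^sup>2)) \<partial>PiM {..<n} (\<lambda>_. M))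
    \<le> ennreal ((1 / sqrt (1 - a * D)) ^ card I)"
proof -
  interpret M: prob_space M by fact
  interpret MP: product_prob_space "\<lambda>_. M" "{..<n}" by (rule product_prob_spaceI) fact
  interpret N: product_prob_space "\<lambda>_. \<gamma>" I by (rule product_prob_spaceI) (rule prob_space_gamma)
  define X where "X = PiM {..<n} (\<lambda>_. M)"
  define Z where "Z = PiM I (\<lambda>_. \<gamma>)"
  interpret X: prob_space X unfolding X_def by (rule prob_space_PiM) (rule M)
  interpret Z: prob_space Z unfolding Z_def by (rule prob_space_gamma_PiM)
  interpret XZ: pair_sigma_finite X Z ..
  have X_u[measurable]: "(\<lambda>x. x u) \<in> X \<rightarrow>\<^sub>M M" if "u \<in> {..<n}" for u
    using that unfolding X_def by measurable
  have Z_i[measurable]: "(\<lambda>z. z i) \<in> borel_measurable Z" if "i \<in> I" for i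
    using measurable_component_singleton[OF that, of "\<lambda>_. \<gamma>"] unfolding Z_def by simp
  \<comment> \<open>This scale makes \<open>a / (2 * n) * t\<^sup>2\<close> equal to
    \<open>(b * t)\<^sup>2 / 2\<close>, the exponent of the Gaussian moment generating
    function.\<close>
  define b where "b = sqrt (a / n)"
  have b: "b\<^sup>2 = a / n" "b \<ge> 0" using \<open>0 \<le> a\<close> by (auto simp: b_def)
  define Y where "Y = (\<lambda>z u x. b * (\<Sum>i\<in>I. z i * v u i x))"
  have Y[measurable]: "Y z u \<in> borel_measurable M" for z u
    unfolding Y_def by measurable
  \<comment> \<open>The moment generating function is read backwards: the exponential of a square is
    a Gaussian average of exponentials linear in the sum, and these split over
    \<open>u\<close>.\<close>
  have lin: "ennreal (exp (a / (2 * n) * (\<Sum>i\<in>I. (\<Sum>u<n. v u i (x u))\<^sup>2)))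
      = (\<integral>\<^sup>+z. exp (\<Sum>u<n. Y z u (x u)) \<partial>Z)" for x
  proof -
    define S where "S = (\<lambda>i. b * (\<Sum>u<n. v u i (x u)))"
    have "a / (2 * n) * (\<Sum>i\<in>I. (\<Sum>u<n. v u i (x u))\<^sup>2) = (\<Sum>i\<in>I. (S i)\<^sup>2 / 2)"
      unfolding sum_distrib_left[of "a / (2 * n)"]
      by (intro sum.cong refl) (simp add: S_def power_mult_distrib b)
    then have "ennreal (exp (a / (2 * n) * (\<Sum>i\<in>I. (\<Sum>u<n. v u i (x u))\<^sup>2)))
        = (\<Prod>i\<in>I. \<integral>\<^sup>+z. exp (S i * z) \<partial>\<gamma>)"
      using \<open>finite I\<close> by (simp add: exp_sum prod_ennreal nn_integral_exp_gamma)
    also have "\<dots> = (\<integral>\<^sup>+z. (\<Prod>i\<in>I. ennreal (exp (S i * z i))) \<partial>Z)"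
      unfolding Z_def using \<open>finite I\<close> by (subst N.product_nn_integral_prod) auto
    also have "\<dots> = (\<integral>\<^sup>+z. exp (\<Sum>i\<in>I. S i * z i) \<partial>Z)"
      using \<open>finite I\<close> by (simp add: exp_sum prod_ennreal)
    also have "(\<lambda>z. \<Sum>i\<in>I. S i * z i) = (\<lambda>z. \<Sum>u<n. Y z u (x u))"
      by (simp add: S_def Y_def sum_distrib_left sum_distrib_right sum.swap[of _ I] ac_simps)
    finally show ?thesis .
  qed
  have Hoeff: "(\<integral>\<^sup>+x. exp (Y z u x) \<partial>M) \<le> exp (b\<^sup>2 * D * (\<Sum>i\<in>I. (z i)\<^sup>2) / 2)" if "u < n" for z u
  proof -
    \<comment> \<open>The Cauchy-Schwarz bound for the functional \<open>Y z u\<close>, given that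
      the vector \<open>v u\<close> has squared length at most \<open>D\<close>.\<close>
    define r where "r = b * sqrt (D * (\<Sum>i\<in>I. (z i)\<^sup>2))"
    have "\<bar>Y z u x\<bar> \<le> r" if "x \<in> space M" for x
    proof -
      have "(\<Sum>i\<in>I. z i * v u i x)\<^sup>2 \<le> (\<Sum>i\<in>I. (z i)\<^sup>2) * (\<Sum>i\<in>I. (v u i x)\<^sup>2)"
        by (rule Cauchy_Schwarz_ineq_sum)
      also have "\<dots> \<le> (\<Sum>i\<in>I. (z i)\<^sup>2) * D"
        by (intro mult_left_mono bound that \<open>u < n\<close> sum_nonneg) auto
      finally have "\<bar>\<Sum>i\<in>I. z i * v u i x\<bar> \<le> sqrt (D * (\<Sum>i\<in>I. (z i)\<^sup>2))"
        by (intro real_le_rsqrt) (simp add: mult.commute)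
      then show ?thesis
        using b by (simp add: Y_def r_def abs_mult mult_left_mono)
    qed
    then interpret interval_bounded_random_variable M "Y z u" "-r" r
      by unfold_locales (auto simp: abs_le_iff intro!: AE_I2 dest: minus_le_iff[THEN iffD1])
    \<comment> \<open>Integrability of the components lets the mean of \<open>Y z u\<close> be
      computed termwise.\<close>
    have "integrable M (v u i)" if "i \<in> I" for i
    proof (rule M.integrable_const_bound[where B="sqrt D"])
      show "AE x in M. norm (v u i x) \<le> sqrt D"
      proof (rule AE_I2)
        fix x assume "x \<in> space M"
        have "(v u i x)\<^sup>2 \<le> (\<Sum>i\<in>I. (v u i x)\<^sup>2)"
          using \<open>finite I\<close> that by (intro member_le_sum) auto
        also have "\<dots> \<le> D" using bound \<open>u < n\<close> \<open>x \<in> space M\<close> by blast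
        finally show "norm (v u i x) \<le> sqrt D" by (simp add: real_le_rsqrt)
      qed
    qed (auto intro: v that)
    then have "integral\<^sup>L M (Y z u) = (0::real)"
      using mean \<open>u < n\<close> by (simp add: Y_def Bochner_Integration.integral_sum)
    \<comment> \<open>Hoeffding's lemma for a centred variable with values in
      \<open>[-r, r]\<close>, an interval of length \<open>2 * r\<close>.\<close>
    then have "(\<integral>\<^sup>+x. exp (Y z u x) \<partial>M) \<le> ennreal (exp ((r - - r)\<^sup>2 / 8))"
      using Hoeffdings_lemma_nn_integral_0[of 1] by simp
    also have "(r - - r)\<^sup>2 / 8 = r\<^sup>2 / 2"
      by (simp add: power2_eq_square)
    also have "r\<^sup>2 = b\<^sup>2 * D * (\<Sum>i\<in>I. (z i)\<^sup>2)"
      using \<open>0 \<le> D\<close> by (simp add: r_def power_mult_distrib sum_nonneg)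
    finally show ?thesis by simp
  qed
  have meas: "(\<lambda>(x, z). ennreal (exp (\<Sum>u<n. Y z u (x u)))) \<in> borel_measurable (X \<Otimes>\<^sub>M Z)"
    unfolding Y_def by measurable
  have "(\<integral>\<^sup>+x. exp (a / (2 * n) * (\<Sum>i\<in>I. (\<Sum>u<n. v u i (x u))\<^sup>2)) \<partial>X)
      = (\<integral>\<^sup>+x. \<integral>\<^sup>+z. exp (\<Sum>u<n. Y z u (x u)) \<partial>Z \<partial>X)"
    by (simp only: lin)
  also have "\<dots> = (\<integral>\<^sup>+z. \<integral>\<^sup>+x. exp (\<Sum>u<n. Y z u (x u)) \<partial>X \<partial>Z)"
    using XZ.Fubini'[OF meas] by simp
  also have "\<dots> = (\<integral>\<^sup>+z. (\<Prod>u<n. \<integral>\<^sup>+x. exp (Y z u x) \<partial>M) \<partial>Z)"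
  proof (rule nn_integral_cong)
    fix z
    show "(\<integral>\<^sup>+x. exp (\<Sum>u<n. Y z u (x u)) \<partial>X) = (\<Prod>u<n. \<integral>\<^sup>+x. exp (Y z u x) \<partial>M)"
      unfolding X_def
      using MP.product_nn_integral_prod[of "{..<n}" "\<lambda>u x. ennreal (exp (Y z u x))"]
      by (simp add: exp_sum prod_ennreal)
  qed
  also have "\<dots> \<le> (\<integral>\<^sup>+z. (\<Prod>u<n. ennreal (exp (b\<^sup>2 * D * (\<Sum>i\<in>I. (z i)\<^sup>2) / 2))) \<partial>Z)"
    by (intro nn_integral_mono prod_mono_ennreal) (use Hoeff in auto)
  also have "\<dots> = (\<integral>\<^sup>+z. (\<Prod>i\<in>I. ennreal (exp (a * D * (z i)\<^sup>2 / 2))) \<partial>Z)"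
  proof (intro nn_integral_cong)
    fix z
    \<comment> \<open>The \<open>n\<close> equal factors cancel the \<open>1 / n\<close> in
      \<open>b\<^sup>2\<close>; this makes the final bound independent of \<open>n\<close>.\<close>
    have "(\<Prod>u<n. exp (b\<^sup>2 * D * (\<Sum>i\<in>I. (z i)\<^sup>2) / 2)) = exp (\<Sum>i\<in>I. a * D * (z i)\<^sup>2 / 2)"
      using \<open>n > 0\<close>
      by (simp add: b sum_distrib_left sum_divide_distrib flip: exp_of_nat_mult)
    then show "(\<Prod>u<n. ennreal (exp (b\<^sup>2 * D * (\<Sum>i\<in>I. (z i)\<^sup>2) / 2)))
        = (\<Prod>i\<in>I. ennreal (exp (a * D * (z i)\<^sup>2 / 2)))"
      using \<open>finite I\<close> by (simp add: prod_ennreal exp_sum ennreal_power)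
  qed
  also have "\<dots> = (\<Prod>i\<in>I. \<integral>\<^sup>+z. ennreal (exp (a * D * z\<^sup>2 / 2)) \<partial>\<gamma>)"
    unfolding Z_def using \<open>finite I\<close> by (subst N.product_nn_integral_prod) auto
  also have "\<dots> = ennreal ((1 / sqrt (1 - a * D)) ^ card I)"
    using \<open>0 \<le> a\<close> \<open>0 \<le> D\<close> \<open>a * D < 1\<close>
    by (simp add: nn_integral_exp_square_gamma ennreal_power)
  finally show ?thesis unfolding X_def .
qed

section \<open>The second moment method\<close>

text \<open>\<open>Z\<close> is the noise and \<open>G\<close> the hidden variable; given
  \<open>x\<close>, the observation is the fixed map \<open>K\<close> applied to noise of law
  \<open>density Z (f x)\<close>. The mixture thus has likelihood ratio \<open>L\<close>, the
  average of \<open>f x\<close>, already on \<open>Z\<close>, and Cauchy-Schwarz applied to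
  \<open>L\<close> and the indicator of the event gives the bound. Working on \<open>Z\<close>
  avoids a density on \<open>S\<close>, where \<open>K\<close> need not be injective.\<close>

lemma emeasure_distr_le_second_moment:
  assumes G: "prob_space G" and Z: "prob_space Z"
    and K: "K \<in> Z \<rightarrow>\<^sub>M S" and F: "(\<lambda>(x, z). F x z) \<in> G \<Otimes>\<^sub>M Z \<rightarrow>\<^sub>M S"
    and T: "\<And>x. x \<in> space G \<Longrightarrow> T x \<in> Z \<rightarrow>\<^sub>M Z"
    and FT: "\<And>x z. x \<in> space G \<Longrightarrow> z \<in> space Z \<Longrightarrow> F x z = K (T x z)"
    and f: "(\<lambda>(x, z). f x z) \<in> borel_measurable (G \<Otimes>\<^sub>M Z)"
    and dens: "\<And>x. x \<in> space G \<Longrightarrow> distr Z Z (T x) = density Z (f x)"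
    and A: "A \<in> sets S"
  shows "(emeasure (distr (G \<Otimes>\<^sub>M Z) S (\<lambda>(x, z). F x z)) A)\<^sup>2
    \<le> (\<integral>\<^sup>+x. \<integral>\<^sup>+y. \<integral>\<^sup>+z. f x z * f y z \<partial>Z \<partial>G \<partial>G) * emeasure (distr Z S K) A"
proof -
  interpret G: prob_space G by fact
  interpret Z: prob_space Z by fact
  interpret GZ: pair_sigma_finite G Z ..
  interpret ZG: pair_sigma_finite Z G ..
  interpret GG: pair_sigma_finite G G ..
  note [measurable] = K F T f A
  define B where "B = K -` A \<inter> space Z"
  have B[measurable]: "B \<in> sets Z" unfolding B_def by measurable
  define L where "L = (\<lambda>z. \<integral>\<^sup>+x. f x z \<partial>G)"
  have fx[measurable]: "f x \<in> borel_measurable Z" if "x \<in> space G" for x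
    using measurable_Pair2[OF f that] by simp
  have f'[measurable]: "(\<lambda>(z, x). f x z) \<in> borel_measurable (Z \<Otimes>\<^sub>M G)"
    using measurable_compose[OF measurable_pair_swap' f] by (simp add: case_prod_unfold)
  have L[measurable]: "L \<in> borel_measurable Z"
    unfolding L_def by measurable
  have "emeasure (distr (G \<Otimes>\<^sub>M Z) S (\<lambda>(x, z). F x z)) A
      = (\<integral>\<^sup>+p. indicator A (case p of (x, z) \<Rightarrow> F x z) \<partial>(G \<Otimes>\<^sub>M Z))"
    by (subst nn_integral_distr[symmetric, OF F]) auto
  also have "\<dots> = (\<integral>\<^sup>+x. \<integral>\<^sup>+z. indicator A (F x z) \<partial>Z \<partial>G)"
    by (subst Z.nn_integral_fst[symmetric]) auto
  \<comment> \<open>Change of measure for each fixed \<open>x\<close>: transformed noise is replaced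
    by plain noise with weight \<open>f x\<close>.\<close>
  also have "\<dots> = (\<integral>\<^sup>+x. \<integral>\<^sup>+z. f x z * indicator B z \<partial>Z \<partial>G)"
  proof (rule nn_integral_cong)
    fix x assume x: "x \<in> space G"
    have "(\<integral>\<^sup>+z. indicator A (F x z) \<partial>Z) = (\<integral>\<^sup>+z. indicator B (T x z) \<partial>Z)"
      using measurable_space[OF T[OF x]]
      by (intro nn_integral_cong) (auto simp: FT[OF x] B_def indicator_def)
    also have "\<dots> = (\<integral>\<^sup>+z. indicator B z \<partial>distr Z Z (T x))"
      using x by (subst nn_integral_distr) auto
    also have "\<dots> = (\<integral>\<^sup>+z. f x z * indicator B z \<partial>Z)"
      using x fx[OF x] by (simp add: dens emeasure_density)
    finally show "(\<integral>\<^sup>+z. indicator A (F x z) \<partial>Z) = (\<integral>\<^sup>+z. f x z * indicator B z \<partial>Z)" .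
  qed
  also have "\<dots> = (\<integral>\<^sup>+z. \<integral>\<^sup>+x. f x z * indicator B z \<partial>G \<partial>Z)"
    by (rule GZ.Fubini'[symmetric]) measurable
  also have "\<dots> = (\<integral>\<^sup>+z. L z * indicator B z \<partial>Z)"
    by (intro nn_integral_cong) (simp add: L_def nn_integral_multc)
  finally have P: "emeasure (distr (G \<Otimes>\<^sub>M Z) S (\<lambda>(x, z). F x z)) A = \<dots>" .
  \<comment> \<open>A squared average is a double average over two independent copies; Fubini then
    moves the noise integral inside.\<close>
  have "(\<integral>\<^sup>+z. (L z)\<^sup>2 \<partial>Z) = (\<integral>\<^sup>+z. \<integral>\<^sup>+x. \<integral>\<^sup>+y. f x z * f y z \<partial>G \<partial>G \<partial>Z)"
  proof (intro nn_integral_cong)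
    fix z assume "z \<in> space Z"
    then have [measurable]: "(\<lambda>x. f x z) \<in> borel_measurable G"
      using measurable_Pair1[OF f] by simp
    show "(L z)\<^sup>2 = (\<integral>\<^sup>+x. \<integral>\<^sup>+y. f x z * f y z \<partial>G \<partial>G)"
      by (simp add: L_def power2_eq_square nn_integral_cmult nn_integral_multc)
  qed
  also have "\<dots> = (\<integral>\<^sup>+x. \<integral>\<^sup>+z. \<integral>\<^sup>+y. f x z * f y z \<partial>G \<partial>Z \<partial>G)"
    by (rule GZ.Fubini') measurable
  also have "\<dots> = (\<integral>\<^sup>+x. \<integral>\<^sup>+y. \<integral>\<^sup>+z. f x z * f y z \<partial>Z \<partial>G \<partial>G)"
    by (intro nn_integral_cong GZ.Fubini') measurable
  finally have L2: "(\<integral>\<^sup>+z. (L z)\<^sup>2 \<partial>Z) = \<dots>" .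
  \<comment> \<open>An indicator is its own square, so the second Cauchy-Schwarz factor is the
    probability of \<open>A\<close> under the image of \<open>Z\<close>.\<close>
  have Q: "(\<integral>\<^sup>+z. (indicator B z)\<^sup>2 \<partial>Z) = emeasure (distr Z S K) A"
  proof -
    have "(indicator B z)\<^sup>2 = (indicator B z :: ennreal)" for z
      by (simp add: indicator_def)
    then show ?thesis
      using K A by (simp add: emeasure_distr B_def[symmetric])
  qed
  show ?thesis
    using Cauchy_Schwarz_nn_integral[OF L borel_measurable_indicator[OF B]]
    by (simp add: P L2 Q)
qed

text \<open>With one constant \<open>C\<close> for all \<open>n\<close>, the probability under
  \<open>P n\<close> is at most the square root of \<open>C\<close> times that under
  \<open>Q n\<close>. The bound is asked for \<open>n > 0\<close>, since the conclusion concerns a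
  limit and the model divides by \<open>n\<close>.\<close>

lemma contiguousI_second_moment:
  assumes "\<And>n. prob_space (P n)" "\<And>n. prob_space (Q n)" "\<And>n. sets (P n) = sets (Q n)"
    and bound: "\<And>n A. n > 0 \<Longrightarrow> A \<in> sets (Q n) \<Longrightarrow>
      (emeasure (P n) A)\<^sup>2 \<le> ennreal C * emeasure (Q n) A"
    and "C \<ge> 0"
  shows "contiguous P Q"
  unfolding contiguous_def
proof (intro conjI allI impI assms)
  fix A assume A: "\<forall>n. A n \<in> sets (Q n)" and lim: "(\<lambda>n. measure (Q n) (A n)) \<longlonglongrightarrow> 0"
  have le: "measure (P n) (A n) \<le> sqrt (C * measure (Q n) (A n))" if "n > 0" for n
  proof -
    interpret P: prob_space "P n" by fact
    interpret Q: prob_space "Q n" by fact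
    have "ennreal ((measure (P n) (A n))\<^sup>2) \<le> ennreal (C * measure (Q n) (A n))"
      using bound[of n "A n"] A that \<open>C \<ge> 0\<close>
      by (simp add: P.emeasure_eq_measure Q.emeasure_eq_measure ennreal_power ennreal_mult)
    then show ?thesis
      using \<open>C \<ge> 0\<close> by (intro real_le_rsqrt) (simp add: ennreal_le_iff)
  qed
  have "(\<lambda>n. sqrt (C * measure (Q n) (A n))) \<longlonglongrightarrow> sqrt (C * 0)"
    by (intro tendsto_intros lim)
  then have "(\<lambda>n. sqrt (C * measure (Q n) (A n))) \<longlonglongrightarrow> 0"
    by simp
  then show "(\<lambda>n. measure (P n) (A n)) \<longlonglongrightarrow> 0"
    by (rule real_tendsto_sandwich[OF _ _ tendsto_const, rotated 2])
       (auto intro!: eventually_sequentiallyI[of 1] le)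
qed

section \<open>Coordinates of structured matrices\<close>

text \<open>
  \<open>A\<close> is the complex representative of an \<open>r \<times> c\<close> matrix over the scalars of type \<open>t\<close>; the entries
  outside its \<open>blk t * r\<close> rows and \<open>blk t * c\<close> columns are arbitrary.
\<close>

definition over :: "field_type \<Rightarrow> nat \<Rightarrow> nat \<Rightarrow> (nat \<Rightarrow> nat \<Rightarrow> complex) \<Rightarrow> bool" where
  "over t r c A \<longleftrightarrow> (\<forall>i<r. \<forall>j<c. case t of
     Real_type \<Rightarrow> Im (A i j) = 0
   | Complex_type \<Rightarrow> True
   | Quaternionic_type \<Rightarrow> A (2 * i + 1) (2 * j + 1) = cnj (A (2 * i) (2 * j)) \<and>
       A (2 * i + 1) (2 * j) = - cnj (A (2 * i) (2 * j + 1)))"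

text \<open>The real components of the scalar at position \<open>(i, j)\<close>, ordered as in
  \<open>scalar_block\<close>. They are read off the first row of its block, which under
  \<open>over\<close> determines the second row.\<close>

definition coord :: "field_type \<Rightarrow> (nat \<Rightarrow> nat \<Rightarrow> complex) \<Rightarrow> nat \<Rightarrow> nat \<Rightarrow> nat \<Rightarrow> real" where
  "coord t A i j k =
     (if k = 0 then Re (A (blk t * i) (blk t * j))
      else if k = 1 then Im (A (blk t * i) (blk t * j))
      else if k = 2 then Re (A (blk t * i) (blk t * j + 1))
      else Im (A (blk t * i) (blk t * j + 1)))"

lemma sum_double: "(\<Sum>p<2 * n. f p) = (\<Sum>i<n. f (2 * i) + f (2 * i + 1))"
  for f :: "nat \<Rightarrow> 'a::comm_monoid_add"
  by (induction n) (simp_all add: ac_simps)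

lemma sum_blk: "(\<Sum>p<blk t * n. f p) = (\<Sum>i<n. \<Sum>a<blk t. f (blk t * i + a))"
  for f :: "nat \<Rightarrow> 'a::comm_monoid_add"
proof -
  have "(\<Sum>a<2. g a) = g 0 + g 1" for g :: "nat \<Rightarrow> 'a"
    by (simp add: numeral_2_eq_2)
  then show ?thesis
    by (cases t) (simp_all add: sum_double)
qed

text \<open>The embedding of the scalars into complex blocks is multiplicative. For quaternions the
  block relations of the product appear after grouping the inner index into pairs
  \<open>2 * l\<close>, \<open>2 * l + 1\<close>.\<close>

lemma over_mult:
  assumes A: "over t r s A" and B: "over t s c B"
  shows "over t r c (\<lambda>p q. \<Sum>l<blk t * s. A p l * B l q)"
proof (cases t)
  case Real_type
  with assms show ?thesis by (simp add: over_def)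
next
  case Complex_type
  then show ?thesis by (simp add: over_def)
next
  case [simp]: Quaternionic_type
  have A': "A (2 * i + 1) (2 * l + 1) = cnj (A (2 * i) (2 * l))"
    "A (2 * i + 1) (2 * l) = - cnj (A (2 * i) (2 * l + 1))" if "i < r" "l < s" for i l
    using A that by (simp_all add: over_def)
  have B': "B (2 * l + 1) (2 * j + 1) = cnj (B (2 * l) (2 * j))"
    "B (2 * l + 1) (2 * j) = - cnj (B (2 * l) (2 * j + 1))" if "l < s" "j < c" for l j
    using B that by (simp_all add: over_def)
  have "(\<Sum>l<2 * s. A (2 * i + 1) l * B l (2 * j + 1)) = cnj (\<Sum>l<2 * s. A (2 * i) l * B l (2 * j))"
    "(\<Sum>l<2 * s. A (2 * i + 1) l * B l (2 * j)) = - cnj (\<Sum>l<2 * s. A (2 * i) l * B l (2 * j + 1))"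
    if "i < r" "j < c" for i j
    unfolding sum_double cnj_sum sum_negf[symmetric] using that
    by (auto intro!: sum.cong simp del: add_Suc_right One_nat_def
        simp add: A'[simplified] B'[simplified])
  then show ?thesis by (simp add: over_def)
qed

lemma over_adjoint:
  assumes "over t r c A"
  shows "over t c r (\<lambda>p q. cnj (A q p))"
  using assms by (cases t) (auto simp: over_def)

lemma over_scale:
  assumes "over t r c A"
  shows "over t r c (\<lambda>p q. of_real x * A p q)"
  using assms by (cases t) (auto simp: over_def)

lemma coord_sum: "coord t (\<lambda>p q. \<Sum>u\<in>U. A u p q) i j k = (\<Sum>u\<in>U. coord t (A u) i j k)"
  by (simp add: coord_def)

lemma over_imp_matrix_block:
  assumes "over t r c A" "i < r" "j < c" "a < blk t" "b < blk t"
  shows "A (blk t * i + a) (blk t * j + b) = scalar_block t (coord t A i j) $$ (a, b)"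
  using assms
  by (cases t) (auto simp: over_def coord_def less_2_cases_iff complex_eq_iff mat_of_rows_list_def)

lemma matrix_over_imp_over:
  assumes "matrix_over t d M"
  shows "over t d d (\<lambda>p q. M $$ (p, q))"
proof (cases t)
  case Real_type
  have "Im (M $$ (i, j)) = 0" if "i < d" "j < d" for i j
    using assms that Real_type unfolding matrix_over_def
    by (fastforce simp: mat_of_rows_list_def)
  with Real_type show ?thesis by (simp add: over_def)
next
  case Complex_type
  then show ?thesis by (simp add: over_def)
next
  case [simp]: Quaternionic_type
  have "M $$ (2 * i + 1, 2 * j + 1) = cnj (M $$ (2 * i, 2 * j)) \<and>
       M $$ (2 * i + 1, 2 * j) = - cnj (M $$ (2 * i, 2 * j + 1))" if "i < d" "j < d" for i j
  proof -
    have "\<exists>x. \<forall>a<blk t. \<forall>b<blk t. M $$ (blk t * i + a, blk t * j + b) = scalar_block t x $$ (a, b)"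
      using assms that unfolding matrix_over_def by blast
    then obtain x where x: "\<forall>a<2. \<forall>b<2. M $$ (2 * i + a, 2 * j + b) = scalar_block t x $$ (a, b)"
      by auto
    show ?thesis
      using x[rule_format, of 0 0] x[rule_format, of 0 1] x[rule_format, of 1 0] x[rule_format, of 1 1]
      by (simp add: mat_of_rows_list_def complex_eq_iff)
  qed
  then show ?thesis by (simp add: over_def)
qed

text \<open>Up to sign, each real component occurs \<open>blk t\<close> times in its block: once for
  real and complex scalars, twice for quaternions. The complex inner product therefore counts the
  component inner product \<open>blk t\<close> times.\<close>

lemma sum_Re_mult_cnj:
  assumes "over t r c A" "over t r c B"
  shows "(\<Sum>p<blk t * r. \<Sum>q<blk t * c. Re (A p q * cnj (B p q)))
    = blk t * (\<Sum>i<r. \<Sum>j<c. \<Sum>k<beta t. coord t A i j k * coord t B i j k)"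
proof -
  have "(\<Sum>a<blk t. \<Sum>b<blk t. Re (A (blk t * i + a) (blk t * j + b) * cnj (B (blk t * i + a) (blk t * j + b))))
    = blk t * (\<Sum>k<beta t. coord t A i j k * coord t B i j k)" if "i < r" "j < c" for i j
    using assms that
    by (cases t) (auto simp: over_def coord_def numeral_eq_Suc)
  then have "(\<Sum>i<r. \<Sum>j<c. \<Sum>a<blk t. \<Sum>b<blk t.
        Re (A (blk t * i + a) (blk t * j + b) * cnj (B (blk t * i + a) (blk t * j + b))))
    = (\<Sum>i<r. \<Sum>j<c. blk t * (\<Sum>k<beta t. coord t A i j k * coord t B i j k))"
    by (intro sum.cong refl) auto
  also have "(\<Sum>i<r. \<Sum>j<c. \<Sum>a<blk t. \<Sum>b<blk t.
        Re (A (blk t * i + a) (blk t * j + b) * cnj (B (blk t * i + a) (blk t * j + b))))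
    = (\<Sum>p<blk t * r. \<Sum>q<blk t * c. Re (A p q * cnj (B p q)))"
    unfolding sum_blk by (intro sum.cong refl sum.swap)
  finally show ?thesis
    by (simp only: sum_distrib_left)
qed

text \<open>The preimage of a Hermitian matrix under \<^const>\<open>hermitian_of_gaussians\<close>.\<close>

definition gcoord :: "field_type \<Rightarrow> (nat \<Rightarrow> nat \<Rightarrow> complex) \<Rightarrow> nat \<times> nat \<times> nat \<Rightarrow> real" where
  "gcoord t A = (\<lambda>(i, j, k).
     if i < j then sqrt (beta t) * coord t A i j k
     else if i = j \<and> k = 0 then sqrt (beta t / 2) * coord t A i i 0 else 0)"

lemma beta_pos: "beta t > 0"
  by (cases t) auto

text \<open>Transposed entries are conjugate scalars, and conjugation keeps the real component and
  negates the others.\<close>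

lemma coord_hermitian:
  assumes "over t N N A" and herm: "\<And>p q. A q p = cnj (A p q)"
    and "i < N" "j < N" "k < beta t"
  shows "coord t A j i k = (if k = 0 then coord t A i j k else - coord t A i j k)"
proof -
  have k: "k = 0 \<or> k = 1 \<or> k = 2 \<or> k = 3" "t \<noteq> Quaternionic_type \<Longrightarrow> k < 2"
    using assms(5) by (cases t; auto)+
  \<comment> \<open>Hermitian symmetry leads from this entry to the second row of the transposed
    block, and the quaternionic relation leads back to the first row.\<close>
  have "A (2 * j) (2 * i + 1) = - A (2 * i) (2 * j + 1)" if "t = Quaternionic_type"
    using assms(1,3,4) that herm[of "2 * j" "2 * i + 1"] by (simp add: over_def)
  then show ?thesis
    using k herm[of "blk t * i" "blk t * j"] by (cases t) (auto simp: coord_def)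
qed

text \<open>The left side weights positions above the diagonal by \<open>beta t\<close> and diagonal
  ones by \<open>beta t / 2\<close>. In the full sum transposed positions contribute equally, so
  half of it has the same weights. The variance \<open>2 / beta\<close> on the diagonal of the
  ensembles is what makes this fit.\<close>

lemma sum_gcoord:
  assumes A: "over t N N A" "\<And>p q. A q p = cnj (A p q)"
    and B: "over t N N B" "\<And>p q. B q p = cnj (B p q)"
  shows "(\<Sum>x\<in>{..<N} \<times> {..<N} \<times> {..<beta t}. gcoord t A x * gcoord t B x)
    = beta t / 2 * (\<Sum>i<N. \<Sum>j<N. \<Sum>k<beta t. coord t A i j k * coord t B i j k)"
proof -
  define c where "c = (\<lambda>i j. \<Sum>k<beta t. coord t A i j k * coord t B i j k)"
  have sym: "c j i = c i j" if "i < N" "j < N" for i j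
    unfolding c_def
    by (intro sum.cong refl) (simp add: coord_hermitian[OF A that] coord_hermitian[OF B that])
  define h where "h = (\<lambda>i j. \<Sum>k<beta t. gcoord t A (i, j, k) * gcoord t B (i, j, k))"
  have h: "h i j = (if i < j then beta t * c i j else if i = j then beta t / 2 * c i i else 0)"
    if "i < N" "j < N" for i j
  proof -
    consider "i < j" | "i = j" | "i > j" by linarith
    then show ?thesis
    proof cases
      case 2
      \<comment> \<open>A diagonal entry is its own conjugate, so only its real component
        survives.\<close>
      have "coord t A i i k = 0" if "0 < k" "k < beta t" for k
        using coord_hermitian[OF A \<open>i < N\<close> \<open>i < N\<close> that(2)] that(1) by simp
      then have "c i i = (\<Sum>k<beta t. if k = 0 then coord t A i i 0 * coord t B i i 0 else 0)"
        unfolding c_def by (intro sum.cong) auto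
      also have "\<dots> = coord t A i i 0 * coord t B i i 0"
        using beta_pos[of t] by simp
      finally have c: "c i i = \<dots>" .
      have "h i i = (\<Sum>k<beta t. if k = 0 then beta t / 2 * (coord t A i i 0 * coord t B i i 0) else 0)"
        unfolding h_def
        by (intro sum.cong) (auto simp: gcoord_def algebra_simps simp flip: power2_eq_square)
      also have "\<dots> = beta t / 2 * c i i"
        using beta_pos[of t] by (simp add: c)
      finally show ?thesis using 2 by simp
    next
      case 1
      have "sqrt (beta t) * x * (sqrt (beta t) * y) = (sqrt (beta t) * sqrt (beta t)) * (x * y)" for x y
        by (simp only: mult_ac)
      then have "sqrt (beta t) * x * (sqrt (beta t) * y) = beta t * (x * y)" for x y
        by simp
      then show ?thesis
        using 1 by (auto simp: h_def c_def gcoord_def sum_distrib_left simp del: mult_cancel_left intro!: sum.cong)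
    next
      case 3
      then show ?thesis
        by (simp add: h_def gcoord_def)
    qed
  qed
  \<comment> \<open>Adding the transposed sum evens out the weights: \<open>h i j + h j i\<close> is
    \<open>beta t * c i j\<close> on and off the diagonal alike.\<close>
  have "2 * (\<Sum>i<N. \<Sum>j<N. h i j) = (\<Sum>i<N. \<Sum>j<N. h i j) + (\<Sum>i<N. \<Sum>j<N. h j i)"
    by (subst (3) sum.swap) simp
  also have "\<dots> = (\<Sum>i<N. \<Sum>j<N. h i j + h j i)"
    by (simp add: sum.distrib)
  also have "\<dots> = (\<Sum>i<N. \<Sum>j<N. beta t * c i j)"
    by (intro sum.cong refl) (auto simp: h sym)
  also have "\<dots> = beta t * (\<Sum>i<N. \<Sum>j<N. c i j)"
    by (simp only: sum_distrib_left)
  finally have "(\<Sum>i<N. \<Sum>j<N. h i j) = beta t / 2 * (\<Sum>i<N. \<Sum>j<N. c i j)"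
    by simp
  then show ?thesis
    by (simp add: h_def c_def sum.cartesian_product')
qed

text \<open>The inner product of \<open>X X^*\<close> and \<open>Y Y^*\<close> is the squared norm
  of \<open>X^* Y\<close>: once the fourfold sum is reordered so that the row sums are innermost,
  they form the entries of \<open>V\<close>.\<close>

lemma sum_gcoord_gram:
  fixes c :: real
  assumes X: "over t N d X" and Y: "over t N d Y"
  defines "gram \<equiv> \<lambda>X p q. of_real c * (\<Sum>r<blk t * d. X p r * cnj (X q r))"
  defines "V \<equiv> \<lambda>r s. \<Sum>p<blk t * N. cnj (X p r) * Y p s"
  shows "(\<Sum>x\<in>{..<N} \<times> {..<N} \<times> {..<beta t}. gcoord t (gram X) x * gcoord t (gram Y) x)
    = beta t / 2 * c\<^sup>2 * (\<Sum>i<d. \<Sum>j<d. \<Sum>k<beta t. (coord t V i j k)\<^sup>2)"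
proof -
  have herm: "gram X q p = cnj (gram X p q)" for X p q
    by (simp add: gram_def mult.commute)
  have over_gram: "over t N N (gram X)" if "over t N d X" for X
    unfolding gram_def using over_scale[OF over_mult[OF that over_adjoint[OF that]]] .
  have V: "over t d d V"
    unfolding V_def using over_mult[OF over_adjoint[OF X] Y] .
  have "(\<Sum>p<blk t * N. \<Sum>q<blk t * N. gram X p q * cnj (gram Y p q))
    = (\<Sum>p<blk t * N. \<Sum>q<blk t * N. \<Sum>r<blk t * d. \<Sum>s<blk t * d.
        of_real (c\<^sup>2) * (X p r * cnj (X q r) * cnj (Y p s) * Y q s))"
  proof (intro sum.cong refl)
    fix p q
    have "gram X p q * cnj (gram Y p q) = of_real (c\<^sup>2) *
      ((\<Sum>r<blk t * d. X p r * cnj (X q r)) * (\<Sum>s<blk t * d. cnj (Y p s) * Y q s))"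
      by (simp add: gram_def power2_eq_square)
    then show "gram X p q * cnj (gram Y p q) = (\<Sum>r<blk t * d. \<Sum>s<blk t * d.
        of_real (c\<^sup>2) * (X p r * cnj (X q r) * cnj (Y p s) * Y q s))"
      by (simp only: sum_product sum_distrib_left[of "of_real (c\<^sup>2)"] mult.assoc)
  qed
  also have "\<dots> = (\<Sum>r<blk t * d. \<Sum>s<blk t * d. \<Sum>p<blk t * N. \<Sum>q<blk t * N.
        of_real (c\<^sup>2) * (X p r * cnj (X q r) * cnj (Y p s) * Y q s))"
    by (simp only: sum.swap[of _ "{..<blk t * d}" "{..<blk t * N}"])
  also have "\<dots> = of_real (c\<^sup>2) * (\<Sum>r<blk t * d. \<Sum>s<blk t * d. V r s * cnj (V r s))"
    unfolding sum_distrib_left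
  proof (intro sum.cong refl)
    fix r s
    have "V r s * cnj (V r s) = (\<Sum>q<blk t * N. cnj (X q r) * Y q s) * (\<Sum>p<blk t * N. X p r * cnj (Y p s))"
      by (simp add: V_def)
    also have "\<dots> = (\<Sum>p<blk t * N. \<Sum>q<blk t * N. X p r * cnj (X q r) * cnj (Y p s) * Y q s)"
      unfolding sum_product by (subst sum.swap) (simp add: mult_ac)
    finally show "(\<Sum>p<blk t * N. \<Sum>q<blk t * N.
        of_real (c\<^sup>2) * (X p r * cnj (X q r) * cnj (Y p s) * Y q s))
      = of_real (c\<^sup>2) * (V r s * cnj (V r s))"
      by (simp only: sum_distrib_left)
  qed
  finally have "Re (\<Sum>p<blk t * N. \<Sum>q<blk t * N. gram X p q * cnj (gram Y p q))
    = Re (of_real (c\<^sup>2) * (\<Sum>r<blk t * d. \<Sum>s<blk t * d. V r s * cnj (V r s)))"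
    by simp
  moreover have "Re (of_real x * z) = x * Re z" for x z
    by simp
  ultimately have "(\<Sum>p<blk t * N. \<Sum>q<blk t * N. Re (gram X p q * cnj (gram Y p q)))
    = c\<^sup>2 * (\<Sum>r<blk t * d. \<Sum>s<blk t * d. Re (V r s * cnj (V r s)))"
    by (simp only: Re_sum)
  \<comment> \<open>Passing to components puts the nonzero factor \<open>blk t\<close> on both
    sides, where it cancels.\<close>
  then have "(\<Sum>i<N. \<Sum>j<N. \<Sum>k<beta t. coord t (gram X) i j k * coord t (gram Y) i j k)
    = c\<^sup>2 * (\<Sum>i<d. \<Sum>j<d. \<Sum>k<beta t. coord t V i j k * coord t V i j k)"
    unfolding sum_Re_mult_cnj[OF over_gram[OF X] over_gram[OF Y]] sum_Re_mult_cnj[OF V V]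
    by (cases t) simp_all
  then show ?thesis
    unfolding sum_gcoord[OF over_gram[OF X] herm over_gram[OF Y] herm]
    by (simp add: power2_eq_square)
qed

lemma scalar_block_add:
  assumes "a < blk t" "b < blk t" "\<And>k. k < beta t \<Longrightarrow> z k = x k + y k"
  shows "scalar_block t z $$ (a, b) = scalar_block t x $$ (a, b) + scalar_block t y $$ (a, b)"
  using assms
  by (cases t) (auto simp: mat_of_rows_list_def less_2_cases_iff complex_eq_iff)

text \<open>The ensemble matrix is linear in its Gaussians, and the scale factors of
  \<open>gcoord\<close> invert those of the ensemble; adding a Hermitian matrix is therefore a
  translation of the Gaussians.\<close>

lemma hermitian_of_gaussians_add:
  assumes A: "over t N N A" and herm: "\<And>p q. A q p = cnj (A p q)"
    and pq: "p < blk t * N" "q < blk t * N"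
  shows "hermitian_of_gaussians t N (\<lambda>x\<in>{..<N} \<times> {..<N} \<times> {..<beta t}. z x + gcoord t A x) $$ (p, q)
    = hermitian_of_gaussians t N z $$ (p, q) + A p q"
proof -
  define i a j b where defs: "i = p div blk t" "a = p mod blk t" "j = q div blk t" "b = q mod blk t"
  have blk: "blk t > 0" by (cases t) auto
  have ab: "a < blk t" "b < blk t" and p: "p = blk t * i + a" and q: "q = blk t * j + b"
    using blk by (simp_all add: defs)
  have ij: "i < N" "j < N"
    using pq by (simp_all add: defs less_mult_imp_div_less mult.commute)
  note block = over_imp_matrix_block[OF A]
  have sq: "sqrt (beta t) > 0" using beta_pos[of t] by simp
  have H: "hermitian_of_gaussians t N z $$ (p, q) =
     (if i < j then scalar_block t (\<lambda>k. z (i, j, k) / sqrt (real (beta t))) $$ (a, b)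
       else if i = j then
         scalar_block t (\<lambda>k. if k = 0 then sqrt (2 / real (beta t)) * z (i, i, 0) else 0) $$ (a, b)
       else cnj (scalar_block t (\<lambda>k. z (j, i, k) / sqrt (real (beta t))) $$ (b, a)))" for z
    unfolding hermitian_of_gaussians_def Let_def defs using pq by simp
  have Apq: "A p q = scalar_block t (coord t A i j) $$ (a, b)"
    by (subst p, subst q) (rule block[OF ij ab])
  let ?z = "\<lambda>x\<in>{..<N} \<times> {..<N} \<times> {..<beta t}. z x + gcoord t A x"
  consider "i < j" | "i = j" | "i > j" by linarith
  then show ?thesis
  proof cases
    case 1
    have "scalar_block t (\<lambda>k. ?z (i, j, k) / sqrt (beta t)) $$ (a, b)
      = scalar_block t (\<lambda>k. z (i, j, k) / sqrt (beta t)) $$ (a, b) + scalar_block t (coord t A i j) $$ (a, b)"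
      by (rule scalar_block_add[OF ab]) (use 1 sq ij in \<open>simp add: gcoord_def add_divide_distrib\<close>)
    then show ?thesis
      unfolding H using 1 Apq by simp
  next
    \<comment> \<open>Below the diagonal the Gaussians are read at the transposed position, so
      Hermitian symmetry is used for \<open>A\<close> as well.\<close>
    case 3
    have "scalar_block t (\<lambda>k. ?z (j, i, k) / sqrt (beta t)) $$ (b, a)
      = scalar_block t (\<lambda>k. z (j, i, k) / sqrt (beta t)) $$ (b, a) + scalar_block t (coord t A j i) $$ (b, a)"
      by (rule scalar_block_add[OF ab(2,1)]) (use 3 sq ij in \<open>simp add: gcoord_def add_divide_distrib\<close>)
    moreover have "A p q = cnj (scalar_block t (coord t A j i) $$ (b, a))"
      by (subst herm, subst p, subst q) (simp add: block ij ab)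
    ultimately show ?thesis
      unfolding H using 3 by simp
  next
    case 2
    have "coord t A i i k = 0" if "0 < k" "k < beta t" for k
      using coord_hermitian[OF A herm \<open>i < N\<close> \<open>i < N\<close> that(2)] that(1) by simp
    moreover have "sqrt (2 / beta t) * (sqrt (beta t / 2) * x) = x" for x
      using beta_pos[of t] unfolding mult.assoc[symmetric] by (simp flip: real_sqrt_mult)
    ultimately have "scalar_block t (\<lambda>k. if k = 0 then sqrt (2 / beta t) * ?z (i, i, 0) else 0) $$ (a, b)
      = scalar_block t (\<lambda>k. if k = 0 then sqrt (2 / beta t) * z (i, i, 0) else 0) $$ (a, b)
        + scalar_block t (coord t A i i) $$ (a, b)"
      by (intro scalar_block_add[OF ab]) (use ij beta_pos[of t] in \<open>simp add: gcoord_def distrib_left\<close>)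
    then show ?thesis
      unfolding H using 2 Apq by simp
  qed
qed

section \<open>Unitary representations\<close>

lemma mat_adjoint_carrier: "A \<in> carrier_mat r c \<Longrightarrow> mat_adjoint A \<in> carrier_mat c r"
  by (auto simp: mat_adjoint_def)

lemma mat_adjoint_index:
  "i < dim_col A \<Longrightarrow> j < dim_row A \<Longrightarrow> mat_adjoint A $$ (i, j) = conjugate (A $$ (j, i))"
  by (simp add: mat_adjoint_def mat_of_rows_index)

lemma mult_mat_index:
  "A \<in> carrier_mat r s \<Longrightarrow> B \<in> carrier_mat s c \<Longrightarrow> i < r \<Longrightarrow> j < c \<Longrightarrow>
    (A * B) $$ (i, j) = (\<Sum>l<s. A $$ (i, l) * B $$ (l, j))"
  by (auto simp: scalar_prod_def atLeast0LessThan intro!: sum.cong)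

lemma unitary_rep_carrier: "unitary_rep m R \<Longrightarrow> R g \<in> carrier_mat m m"
  by (simp add: unitary_rep_def)

lemma unitary_rep_rows:
  assumes "unitary_rep m R" "p < m" "q < m"
  shows "(\<Sum>s<m. R g $$ (p, s) * cnj (R g $$ (q, s))) = (if p = q then 1 else 0)"
proof -
  have R: "R g \<in> carrier_mat m m" "R g * mat_adjoint (R g) = 1\<^sub>m m"
    using assms by (auto simp: unitary_rep_def)
  have "(\<Sum>s<m. R g $$ (p, s) * mat_adjoint (R g) $$ (s, q)) = 1\<^sub>m m $$ (p, q)"
    using mult_mat_index[OF R(1) mat_adjoint_carrier[OF R(1)], of p q] assms R(2) by simp
  then show ?thesis
    using R(1) assms by (simp add: mat_adjoint_index)
qed

text \<open>A right inverse of a square matrix is also a left inverse.\<close>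

lemma unitary_rep_cols:
  assumes "unitary_rep m R" "p < m" "q < m"
  shows "(\<Sum>s<m. cnj (R g $$ (s, p)) * R g $$ (s, q)) = (if p = q then 1 else 0)"
proof -
  have R: "R g \<in> carrier_mat m m" "R g * mat_adjoint (R g) = 1\<^sub>m m"
    using assms by (auto simp: unitary_rep_def)
  have "mat_adjoint (R g) * R g = 1\<^sub>m m"
    by (rule mat_mult_left_right_inverse[OF R(1) mat_adjoint_carrier[OF R(1)] R(2)])
  then have "(\<Sum>s<m. mat_adjoint (R g) $$ (p, s) * R g $$ (s, q)) = 1\<^sub>m m $$ (p, q)"
    using mult_mat_index[OF mat_adjoint_carrier[OF R(1)] R(1), of p q] assms by simp
  then show ?thesis
    using R(1) assms by (simp add: mat_adjoint_index)
qed

lemma unitary_rep_norm_le: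
  assumes "unitary_rep m R" "p < m" "q < m"
  shows "norm (R g $$ (p, q)) \<le> 1"
proof -
  have "Re (z * cnj z) = (norm z)\<^sup>2" for z
    by (simp add: cmod_power2) (simp add: power2_eq_square)
  then have "(\<Sum>s<m. (norm (R g $$ (p, s)))\<^sup>2) = Re (\<Sum>s<m. R g $$ (p, s) * cnj (R g $$ (p, s)))"
    by (simp only: Re_sum)
  then have "(\<Sum>s<m. (norm (R g $$ (p, s)))\<^sup>2) = 1"
    by (simp only: unitary_rep_rows[OF assms(1,2,2)]) simp
  moreover have "(norm (R g $$ (p, q)))\<^sup>2 \<le> (\<Sum>s<m. (norm (R g $$ (p, s)))\<^sup>2)"
    using assms by (intro member_le_sum) auto
  ultimately show ?thesis
    using abs_square_le_1[of "norm (R g $$ (p, q))"] by simp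
qed

lemma unitary_rep_measurable:
  assumes "unitary_rep m R" "haar_probability \<mu>" "p < m" "q < m"
  shows "(\<lambda>g. R g $$ (p, q)) \<in> borel_measurable \<mu>"
proof -
  have "continuous_on UNIV (\<lambda>g. R g $$ (p, q))" "sets \<mu> = sets borel"
    using assms by (auto simp: unitary_rep_def haar_probability_def)
  then show ?thesis
    using borel_measurable_continuous_onI measurable_cong_sets by blast
qed

lemma unitary_rep_integrable:
  assumes "unitary_rep m R" "haar_probability \<mu>" "p < m" "q < m"
  shows "integrable \<mu> (\<lambda>g. R g $$ (p, q))"
proof -
  interpret prob_space \<mu> using assms by (simp add: haar_probability_def)
  show ?thesis
    using unitary_rep_norm_le[OF assms(1,3,4)] unitary_rep_measurable[OF assms]
    by (intro integrable_const_bound[of _ 1]) auto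
qed

text \<open>By left invariance of the Haar measure, each column of the averaged matrix is fixed by
  every \<open>R h\<close>, so its multiples form an invariant subspace. Irreducibility leaves two
  cases: the column vanishes, or its multiples fill the space and the representation is
  trivial.\<close>

lemma integral_unitary_rep_eq_0:
  fixes R :: "'g::{topological_group_add,t2_space} \<Rightarrow> complex mat"
  assumes haar: "haar_probability \<mu>" and R: "unitary_rep m R" and irr: "irreducible_rep m R"
    and nontriv: "\<not> isomorphic_reps m R 1 (\<lambda>g. 1\<^sub>m 1)" and "i < m" "j < m"
  shows "(\<integral>g. R g $$ (i, j) \<partial>\<mu>) = 0"
proof -
  note carrier = unitary_rep_carrier[OF R]
  note integrable = unitary_rep_integrable[OF R haar]
  have sets: "sets \<mu> = sets borel" and inv: "distr \<mu> \<mu> (\<lambda>g. h + g) = \<mu>" for h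
    using haar by (auto simp: haar_probability_def)
  have shift: "(\<lambda>g. h + g) \<in> \<mu> \<rightarrow>\<^sub>M \<mu>" for h
  proof -
    have "(\<lambda>g. h + g) \<in> borel \<rightarrow>\<^sub>M borel"
      by (intro borel_measurable_continuous_onI continuous_intros)
    then show ?thesis
      using sets measurable_cong_sets by blast
  qed
  define v where "v = Matrix.vec m (\<lambda>i. \<integral>g. R g $$ (i, j) \<partial>\<mu>)"
  have v: "v \<in> carrier_vec m" by (simp add: v_def)
  have fixed: "R h *\<^sub>v v = v" for h
  proof (rule eq_vecI)
    fix i assume "i < dim_vec v"
    then have i: "i < m" by (simp add: v_def)
    have "(R h *\<^sub>v v) $ i = (\<Sum>k<m. R h $$ (i, k) * (\<integral>g. R g $$ (k, j) \<partial>\<mu>))"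
      using carrier[of h] i by (auto simp: scalar_prod_def v_def atLeast0LessThan)
    also have "\<dots> = (\<integral>g. (\<Sum>k<m. R h $$ (i, k) * R g $$ (k, j)) \<partial>\<mu>)"
      using \<open>j < m\<close> integrable by (subst Bochner_Integration.integral_sum) auto
    also have "\<dots> = (\<integral>g. R (h + g) $$ (i, j) \<partial>\<mu>)"
      using R mult_mat_index[OF carrier carrier i \<open>j < m\<close>] by (simp add: unitary_rep_def)
    also have "\<dots> = (\<integral>g. R g $$ (i, j) \<partial>distr \<mu> \<mu> (\<lambda>g. h + g))"
      using unitary_rep_measurable[OF R haar i \<open>j < m\<close>] shift by (subst integral_distr) auto
    finally show "(R h *\<^sub>v v) $ i = v $ i"
      using i by (simp add: inv v_def)
  qed (use carrier in \<open>auto simp: v_def\<close>)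
  \<comment> \<open>A line, or the zero subspace if \<open>v\<close> vanishes.\<close>
  define V where "V = range (\<lambda>c. c \<cdot>\<^sub>v v)"
  have "subspace class_ring V (module_vec TYPE(complex) m)"
    unfolding subspace_def submodule_def
  proof (intro conjI vec_vs vec_module allI impI)
    show "V \<subseteq> carrier (module_vec TYPE(complex) m)"
      using v by (auto simp: V_def module_vec_simps)
    show "x \<oplus>\<^bsub>module_vec TYPE(complex) m\<^esub> y \<in> V" if "x \<in> V" "y \<in> V" for x y
      using that by (auto simp: V_def module_vec_simps image_iff simp flip: add_smult_distrib_vec)
    have "0\<^sub>v m = 0 \<cdot>\<^sub>v v" using v by auto
    then show "\<zero>\<^bsub>module_vec TYPE(complex) m\<^esub> \<in> V"
      by (auto simp: V_def module_vec_simps)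
    show "c \<odot>\<^bsub>module_vec TYPE(complex) m\<^esub> x \<in> V" if "x \<in> V" for c x
      using that by (auto simp: V_def module_vec_simps smult_smult_assoc image_iff)
  qed
  moreover have "R g *\<^sub>v w \<in> V" if "w \<in> V" for g w
    using that v carrier[of g] fixed[of g] by (auto simp: V_def mult_mat_vec)
  ultimately have "V = {0\<^sub>v m} \<or> V = carrier_vec m"
    using irr unfolding irreducible_rep_def by blast
  then show ?thesis
  proof
    assume "V = {0\<^sub>v m}"
    moreover have "v \<in> V" unfolding V_def by (rule range_eqI[of _ _ 1]) simp
    ultimately have "v = 0\<^sub>v m" by simp
    then have "v $ i = 0" using \<open>i < m\<close> by simp
    then show ?thesis using \<open>i < m\<close> by (simp add: v_def)
  next
    assume V: "V = carrier_vec m"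
    have unit: "\<exists>c. unit_vec m k = c \<cdot>\<^sub>v v" for k
      using V unit_vec_carrier[of m k] by (auto simp: V_def)
    \<comment> \<open>Two different unit vectors cannot both be multiples of
      \<open>v\<close>.\<close>
    have "m = 1"
    proof (rule ccontr)
      assume "m \<noteq> 1"
      then have m: "0 < m" "1 < m" using \<open>i < m\<close> by auto
      obtain c c' where c: "unit_vec m 0 = c \<cdot>\<^sub>v v" and c': "unit_vec m 1 = c' \<cdot>\<^sub>v v"
        using unit by blast
      have "c * v $ 0 = 1" "c' * v $ 0 = 0" "c' * v $ 1 = 1"
        using arg_cong[OF c, of "\<lambda>x. vec_index x 0"] arg_cong[OF c', of "\<lambda>x. vec_index x 0"]
          arg_cong[OF c', of "\<lambda>x. vec_index x 1"] m v by auto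
      then show False by auto
    qed
    have "R g = 1\<^sub>m 1" for g
    proof -
      obtain c where c: "unit_vec m 0 = c \<cdot>\<^sub>v v" using unit by blast
      \<comment> \<open>The unit vector is a multiple of the fixed vector \<open>v\<close>, hence
        fixed itself; so the only entry of \<open>R g\<close> is 1.\<close>
      have "R g *\<^sub>v unit_vec m 0 = unit_vec m 0"
        unfolding c using mult_mat_vec[OF carrier v] fixed by simp
      then have "(R g *\<^sub>v unit_vec m 0) $ 0 = 1"
        using \<open>m = 1\<close> by simp
      then have "R g $$ (0, 0) = 1"
        using carrier[of g] \<open>m = 1\<close> by (auto simp: scalar_prod_def)
      then show ?thesis
        using carrier[of g] \<open>m = 1\<close> by (intro eq_matI) auto
    qed
    moreover have "invertible_mat (1\<^sub>m 1 :: complex mat)"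
      unfolding invertible_mat_def inverts_mat_def by (intro conjI exI[of _ "1\<^sub>m 1"]) auto
    ultimately have "isomorphic_reps m R 1 (\<lambda>g. 1\<^sub>m 1)"
      unfolding isomorphic_reps_def using \<open>m = 1\<close> by (intro conjI bexI[of _ "1\<^sub>m 1"]) auto
    with nontriv show ?thesis by simp
  qed
qed

section \<open>Measurability\<close>

lemma measurable_matrix_space:
  assumes "\<And>x. x \<in> space M \<Longrightarrow> f x \<in> carrier_mat N N"
    and "\<And>p q. p < N \<Longrightarrow> q < N \<Longrightarrow> (\<lambda>x. f x $$ (p, q)) \<in> borel_measurable M"
  shows "f \<in> M \<rightarrow>\<^sub>M matrix_space N"
  unfolding matrix_space_def
  using assms by (intro measurable_vimage_algebra2 measurable_restrict) auto

lemma matrix_space_index_measurable: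
  assumes "p < N" "q < N"
  shows "(\<lambda>M. M $$ (p, q)) \<in> borel_measurable (matrix_space N)"
proof -
  let ?J = "{..<N} \<times> {..<N}"
  have "(\<lambda>M. \<lambda>x\<in>?J. M $$ x) \<in> matrix_space N \<rightarrow>\<^sub>M PiM ?J (\<lambda>_. borel :: complex measure)"
    unfolding matrix_space_def by (rule measurable_vimage_algebra1) (auto simp: space_PiM)
  from measurable_compose[OF this measurable_component_singleton[of "(p, q)"]]
  show ?thesis using assms by simp
qed

lemma space_matrix_space: "space (matrix_space N) = carrier_mat N N"
  by (simp add: matrix_space_def)

lemma scalar_block_measurable:
  assumes [measurable]: "\<And>k. k < beta t \<Longrightarrow> (\<lambda>z. x z k) \<in> borel_measurable M"
    and "a < blk t" "b < blk t"
  shows "(\<lambda>z. scalar_block t (x z) $$ (a, b)) \<in> borel_measurable M"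
  using assms
  by (cases t) (auto simp: mat_of_rows_list_def less_2_cases_iff borel_measurable_complex_iff)

lemma coord_measurable:
  assumes "\<And>p q. p < blk t * r \<Longrightarrow> q < blk t * c \<Longrightarrow> (\<lambda>x. A x p q) \<in> borel_measurable M"
    and "i < r" "j < c" "k < beta t"
  shows "(\<lambda>x. coord t (A x) i j k) \<in> borel_measurable M"
proof -
  have k: "k = 0 \<or> k = 1 \<or> k = 2 \<or> k = 3" "t \<noteq> Quaternionic_type \<Longrightarrow> k < 2"
    using assms(4) by (cases t; auto)+
  have "blk t * i < blk t * r" "blk t * j < blk t * c"
    using assms by (cases t; simp)+
  note 0 = assms(1)[OF this]
  have 1: "(\<lambda>x. A x (blk t * i) (blk t * j + 1)) \<in> borel_measurable M"
    if "t = Quaternionic_type"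
    using assms that by (intro assms(1)) auto
  show ?thesis
    using k 0 1
    by (cases "t = Quaternionic_type") (auto simp: coord_def borel_measurable_complex_iff)
qed

text \<open>The components are real-linear in the complex entries and inherit their zero
  mean.\<close>

lemma integral_coord_eq_0:
  assumes "\<And>p q. p < blk t * r \<Longrightarrow> q < blk t * c \<Longrightarrow> integrable M (\<lambda>x. A x p q)"
    and "\<And>p q. p < blk t * r \<Longrightarrow> q < blk t * c \<Longrightarrow> (\<integral>x. A x p q \<partial>M) = 0"
    and "i < r" "j < c" "k < beta t"
  shows "(\<integral>x. coord t (A x) i j k \<partial>M) = 0"
proof -
  have k: "k = 0 \<or> k = 1 \<or> k = 2 \<or> k = 3" "t \<noteq> Quaternionic_type \<Longrightarrow> k < 2"
    using assms(5) by (cases t; auto)+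
  have "blk t * i < blk t * r" "blk t * j < blk t * c"
    using assms by (cases t; simp)+
  note 0 = assms(1,2)[OF this]
  have 1: "integrable M (\<lambda>x. A x (blk t * i) (blk t * j + 1))"
    "(\<integral>x. A x (blk t * i) (blk t * j + 1) \<partial>M) = 0"
    if "t = Quaternionic_type"
    using assms that by auto
  show ?thesis
    using k 0 1 by (cases "t = Quaternionic_type") (auto simp: coord_def)
qed

lemma gcoord_measurable:
  assumes "\<And>p q. p < blk t * N \<Longrightarrow> q < blk t * N \<Longrightarrow> (\<lambda>x. A x p q) \<in> borel_measurable M"
    and "y \<in> {..<N} \<times> {..<N} \<times> {..<beta t}"
  shows "(\<lambda>x. gcoord t (A x) y) \<in> borel_measurable M"
proof -
  obtain i j k where y: "y = (i, j, k)" "i < N" "j < N" "k < beta t"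
    using assms(2) by auto
  have [measurable]: "(\<lambda>x. coord t (A x) i j k) \<in> borel_measurable M"
    "(\<lambda>x. coord t (A x) i i 0) \<in> borel_measurable M"
    using y beta_pos[of t] by (auto intro!: coord_measurable assms(1))
  show ?thesis
    unfolding gcoord_def y(1) by simp
qed

lemma blk_pos: "blk t > 0"
  by (cases t) auto

lemma hermitian_of_gaussians_measurable:
  "hermitian_of_gaussians t N \<in> PiM ({..<N} \<times> {..<N} \<times> {..<beta t}) (\<lambda>_. \<gamma>) \<rightarrow>\<^sub>M matrix_space (blk t * N)"
proof (rule measurable_matrix_space)
  show "hermitian_of_gaussians t N z \<in> carrier_mat (blk t * N) (blk t * N)" for z
    by (simp add: hermitian_of_gaussians_def)
next
  let ?Z = "PiM ({..<N} \<times> {..<N} \<times> {..<beta t}) (\<lambda>_. \<gamma>)"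
  fix p q assume pq: "p < blk t * N" "q < blk t * N"
  define i a j b where defs: "i = p div blk t" "a = p mod blk t" "j = q div blk t" "b = q mod blk t"
  have ab: "a < blk t" "b < blk t"
    using blk_pos by (simp_all add: defs)
  have ij: "i < N" "j < N"
    using pq by (simp_all add: defs less_mult_imp_div_less mult.commute)
  have z[measurable]: "(\<lambda>z. z (i, j, k)) \<in> borel_measurable ?Z" if "i < N" "j < N" "k < beta t" for i j k
    using measurable_component_singleton[of "(i, j, k)" "{..<N} \<times> {..<N} \<times> {..<beta t}" "\<lambda>_. \<gamma>"] that
    by simp
  have H: "hermitian_of_gaussians t N z $$ (p, q) =
     (if i < j then scalar_block t (\<lambda>k. z (i, j, k) / sqrt (real (beta t))) $$ (a, b)
       else if i = j then
         scalar_block t (\<lambda>k. if k = 0 then sqrt (2 / real (beta t)) * z (i, i, 0) else 0) $$ (a, b)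
       else cnj (scalar_block t (\<lambda>k. z (j, i, k) / sqrt (real (beta t))) $$ (b, a)))" for z
    unfolding hermitian_of_gaussians_def Let_def defs using pq by simp
  have 1: "(\<lambda>z. scalar_block t (\<lambda>k. z (i, j, k) / sqrt (real (beta t))) $$ (a, b)) \<in> borel_measurable ?Z"
    if "i < N" "j < N" "a < blk t" "b < blk t" for i j a b
    by (rule scalar_block_measurable) (use that z[of i j] in simp_all)
  have 2: "(\<lambda>z. scalar_block t (\<lambda>k. if k = 0 then sqrt (2 / real (beta t)) * z (i, i, 0) else 0) $$ (a, b))
      \<in> borel_measurable ?Z"
  proof (rule scalar_block_measurable[OF _ ab])
    fix k
    have "(\<lambda>z. z (i, i, 0)) \<in> borel_measurable ?Z"
      using z[of i i 0] ij beta_pos by auto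
    then show "(\<lambda>z. if k = 0 then sqrt (2 / real (beta t)) * z (i, i, 0) else 0) \<in> borel_measurable ?Z"
      by (cases "k = 0") auto
  qed
  have 3: "(\<lambda>z. cnj (scalar_block t (\<lambda>k. z (j, i, k) / sqrt (real (beta t))) $$ (b, a))) \<in> borel_measurable ?Z"
    using 1[OF ij(2,1) ab(2,1)] by (simp add: borel_measurable_complex_iff)
  show "(\<lambda>z. hermitian_of_gaussians t N z $$ (p, q)) \<in> borel_measurable ?Z"
    unfolding H using 1[OF ij ab] 2 3 by simp
qed

section \<open>The likelihood ratio of the synchronization model\<close>

text \<open>The entries of the stacked matrix as an index function, the form on which
  \<open>over\<close> and \<open>gcoord\<close> operate.\<close>

definition signal :: "'g frequency \<Rightarrow> (nat \<Rightarrow> 'g) \<Rightarrow> nat \<Rightarrow> nat \<Rightarrow> complex" where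
  "signal \<rho> g p q = frep \<rho> (g (p div cdim \<rho>)) $$ (p mod cdim \<rho>, q)"

text \<open>The matrix \<rho>(x)^* \<rho>(y); at \<open>x = g u\<close> and \<open>y = g' u\<close>
  it is the V_u of the overview.\<close>

definition overlap :: "'g frequency \<Rightarrow> 'g \<Rightarrow> 'g \<Rightarrow> nat \<Rightarrow> nat \<Rightarrow> complex" where
  "overlap \<rho> x y r s = (\<Sum>p<cdim \<rho>. cnj (frep \<rho> x $$ (p, r)) * frep \<rho> y $$ (p, s))"

definition noise_index :: "nat \<Rightarrow> 'g frequency \<Rightarrow> (nat \<times> nat \<times> nat) set" where
  "noise_index n \<rho> = {..<n * fdim \<rho>} \<times> {..<n * fdim \<rho>} \<times> {..<beta (ftype \<rho>)}"

definition noise_law :: "nat \<Rightarrow> 'g frequency set \<Rightarrow> ('g frequency \<Rightarrow> nat \<times> nat \<times> nat \<Rightarrow> real) measure" where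
  "noise_law n \<Psi> = PiM \<Psi> (\<lambda>\<rho>. PiM (noise_index n \<rho>) (\<lambda>_. \<gamma>))"

text \<open>The Gaussian coordinates of the signal after rescaling the noise to unit variance.\<close>

definition mean_coord :: "nat \<Rightarrow> real \<Rightarrow> 'g frequency \<Rightarrow> (nat \<Rightarrow> 'g) \<Rightarrow> nat \<times> nat \<times> nat \<Rightarrow> real" where
  "mean_coord n l \<rho> g = gcoord (ftype \<rho>) (\<lambda>p q. of_real (l * sqrt (n * fdim \<rho>) / n) *
     (\<Sum>r<blk (ftype \<rho>) * fdim \<rho>. signal \<rho> g p r * cnj (signal \<rho> g q r)))"

lemma is_frequencyD:
  assumes "is_frequency \<rho>"
  shows "unitary_rep (cdim \<rho>) (frep \<rho>)" "irreducible_rep (cdim \<rho>) (frep \<rho>)"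
    "over (ftype \<rho>) (fdim \<rho>) (fdim \<rho>) (\<lambda>p q. frep \<rho> g $$ (p, q))" "fdim \<rho> > 0"
proof -
  show "unitary_rep (cdim \<rho>) (frep \<rho>)" "irreducible_rep (cdim \<rho>) (frep \<rho>)"
    using assms by (auto simp: is_frequency_def)
  then show "fdim \<rho> > 0"
    by (cases "fdim \<rho> = 0") (auto simp: irreducible_rep_def cdim_def)
  show "over (ftype \<rho>) (fdim \<rho>) (fdim \<rho>) (\<lambda>p q. frep \<rho> g $$ (p, q))"
    using assms by (auto simp: is_frequency_def intro: matrix_over_imp_over)
qed

text \<open>Since \<open>cdim \<rho>\<close> is a multiple of the block size, the rows of a scalar
  block lie within a single matrix \<open>frep \<rho> (g u)\<close>.\<close>

lemma over_signal:
  assumes "is_frequency \<rho>"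
  shows "over (ftype \<rho>) (n * fdim \<rho>) (fdim \<rho>) (signal \<rho> g)"
proof -
  note d = is_frequencyD(4)[OF assms] and over = is_frequencyD(3)[OF assms]
  have index: "(blk t * i + a) div (blk t * fdim \<rho>) = i div fdim \<rho>"
    "(blk t * i + a) mod (blk t * fdim \<rho>) = blk t * (i mod fdim \<rho>) + a"
    if "a < blk t" for t i a
    using that blk_pos[of t] by (simp_all add: div_mult2_eq mod_mult2_eq)
  show ?thesis
  proof (cases "ftype \<rho>")
    case Real_type
    then show ?thesis
      using over d by (simp add: over_def signal_def cdim_def)
  next
    case Complex_type
    then show ?thesis by (simp add: over_def)
  next
    case Quaternionic_type
    then show ?thesis
      using over d index[of 0 Quaternionic_type] index[of 1 Quaternionic_type]
      by (simp add: over_def signal_def cdim_def)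
  qed
qed

section \<open>The observation as a fixed function of shifted Gaussians\<close>

lemma observation_carrier:
  "W \<in> carrier_mat (n * cdim \<rho>) (n * cdim \<rho>) \<Longrightarrow>
    observation n l \<rho> g W \<in> carrier_mat (n * cdim \<rho>) (n * cdim \<rho>)"
  by (simp add: observation_def)

lemma observation_index:
  assumes "W \<in> carrier_mat (n * cdim \<rho>) (n * cdim \<rho>)" "p < n * cdim \<rho>" "q < n * cdim \<rho>"
  shows "observation n l \<rho> g W $$ (p, q) =
    of_real (l / n) * (\<Sum>r<cdim \<rho>. signal \<rho> g p r * cnj (signal \<rho> g q r))
    + of_real (1 / sqrt (real (n * fdim \<rho>))) * W $$ (p, q)"
proof -
  have X: "stacked n \<rho> g \<in> carrier_mat (n * cdim \<rho>) (cdim \<rho>)"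
    by (simp add: stacked_def)
  have "(stacked n \<rho> g * mat_adjoint (stacked n \<rho> g)) $$ (p, q)
    = (\<Sum>r<cdim \<rho>. stacked n \<rho> g $$ (p, r) * mat_adjoint (stacked n \<rho> g) $$ (r, q))"
    by (rule mult_mat_index[OF X mat_adjoint_carrier[OF X] assms(2,3)])
  also have "\<dots> = (\<Sum>r<cdim \<rho>. signal \<rho> g p r * cnj (signal \<rho> g q r))"
    using X assms by (intro sum.cong refl) (simp add: mat_adjoint_index, simp add: stacked_def signal_def)
  finally have eq: "(stacked n \<rho> g * mat_adjoint (stacked n \<rho> g)) $$ (p, q) = \<dots>" .
  define G where "G = stacked n \<rho> g * mat_adjoint (stacked n \<rho> g)"
  have "G \<in> carrier_mat (n * cdim \<rho>) (n * cdim \<rho>)"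
    unfolding G_def using X mat_adjoint_carrier[OF X] by simp
  then show ?thesis
    unfolding observation_def G_def[symmetric] eq[folded G_def, symmetric]
    using assms by (auto simp del: of_real_divide)
qed

lemma hermitian_of_gaussians_carrier:
  "hermitian_of_gaussians (ftype \<rho>) (n * fdim \<rho>) z \<in> carrier_mat (n * cdim \<rho>) (n * cdim \<rho>)"
  by (simp add: hermitian_of_gaussians_def cdim_def mult.left_commute)

text \<open>The scaled Gram matrix of the signal is Hermitian over the scalars, so the Gaussians can
  absorb it. On the right the signal has coefficient 0 and \<open>g'\<close> is arbitrary: one map,
  common to all \<open>g\<close>, is applied to shifted noise.\<close>

lemma observation_eq_shift:
  assumes "is_frequency \<rho>" "n > 0"
  shows "observation n l \<rho> g (hermitian_of_gaussians (ftype \<rho>) (n * fdim \<rho>) z)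
    = observation n 0 \<rho> g' (hermitian_of_gaussians (ftype \<rho>) (n * fdim \<rho>)
        (\<lambda>x\<in>noise_index n \<rho>. z x + mean_coord n l \<rho> g x))"
proof (rule eq_matI, goal_cases)
  case (1 p q)
  note H = hermitian_of_gaussians_carrier[of \<rho> n]
  have pq: "p < n * cdim \<rho>" "q < n * cdim \<rho>"
    using 1 carrier_matD[OF observation_carrier[OF H, where l=0 and g=g']] by simp_all
  then have pq': "p < blk (ftype \<rho>) * (n * fdim \<rho>)" "q < blk (ftype \<rho>) * (n * fdim \<rho>)"
    by (simp_all add: cdim_def mult.left_commute)
  define c where "c = l * sqrt (n * fdim \<rho>) / n"
  define A where "A = (\<lambda>p q. of_real c *
     (\<Sum>r<blk (ftype \<rho>) * fdim \<rho>. signal \<rho> g p r * cnj (signal \<rho> g q r)))"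
  have X: "over (ftype \<rho>) (n * fdim \<rho>) (fdim \<rho>) (signal \<rho> g)"
    by (rule over_signal[OF assms(1)])
  have over: "over (ftype \<rho>) (n * fdim \<rho>) (n * fdim \<rho>) A"
    unfolding A_def by (intro over_scale over_mult[OF X] over_adjoint X)
  have herm: "A q p = cnj (A p q)" for p q
    by (simp add: A_def mult.commute)
  \<comment> \<open>Factoring out the noise scale turns the signal coefficient into
    \<open>c\<close>; \<open>n\<close> and \<open>fdim \<rho>\<close> are positive, so the square
    root can be cancelled.\<close>
  have "l / n = 1 / sqrt (n * fdim \<rho>) * c"
    using assms is_frequencyD(4)[OF assms(1)] by (simp add: c_def)
  then have c: "of_real (l / n) = of_real (1 / sqrt (n * fdim \<rho>)) * (of_real c :: complex)"
    by (simp only: of_real_mult)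
  have add: "hermitian_of_gaussians (ftype \<rho>) (n * fdim \<rho>)
        (\<lambda>x\<in>noise_index n \<rho>. z x + mean_coord n l \<rho> g x) $$ (p, q)
      = hermitian_of_gaussians (ftype \<rho>) (n * fdim \<rho>) z $$ (p, q) + A p q"
    using hermitian_of_gaussians_add[OF over herm pq']
    unfolding noise_index_def mean_coord_def A_def c_def .
  show ?case
    unfolding observation_index[OF H pq] add c
    by (simp add: A_def cdim_def algebra_simps del: of_real_divide)
qed (simp_all add: carrier_matD[OF observation_carrier[OF hermitian_of_gaussians_carrier]])

lemma observation_0:
  assumes "W \<in> carrier_mat (n * cdim \<rho>) (n * cdim \<rho>)"
  shows "observation n 0 \<rho> g W = observation n 0 \<rho> g' W"
  by (rule eq_matI)
     (simp_all add: carrier_matD[OF observation_carrier[OF assms]] observation_index[OF assms])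

section \<open>The second moment exponent in terms of overlaps\<close>

lemma over_overlap:
  assumes "is_frequency \<rho>"
  shows "over (ftype \<rho>) (fdim \<rho>) (fdim \<rho>) (overlap \<rho> x y)"
  unfolding overlap_def cdim_def
  by (intro over_mult over_adjoint is_frequencyD(3) assms)

lemma sum_nat_blocks: "(\<Sum>p<n * m. f p) = (\<Sum>u<n. \<Sum>a<m. f (u * m + a))"
  for f :: "nat \<Rightarrow> 'a::comm_monoid_add"
proof (induction n)
  case (Suc n)
  have Un: "{..<Suc n * m} = {..<n * m} \<union> {n * m..<n * m + m}" by auto
  have "(\<Sum>p<Suc n * m. f p) = (\<Sum>p<n * m. f p) + (\<Sum>p=n * m..<n * m + m. f p)"
    unfolding Un by (rule sum.union_disjoint) auto
  also have "(\<Sum>p=n * m..<n * m + m. f p) = (\<Sum>a<m. f (n * m + a))"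
    using sum.shift_bounds_nat_ivl[of f 0 "n * m" m]
    by (simp add: atLeast0LessThan add.commute)
  finally show ?case by (simp add: Suc)
qed simp

text \<open>The rows are cut into \<open>n\<close> groups of \<open>cdim \<rho>\<close>, one for
  each group element.\<close>

lemma sum_signal_mult_signal:
  assumes "is_frequency \<rho>"
  shows "(\<Sum>p<blk (ftype \<rho>) * (n * fdim \<rho>). cnj (signal \<rho> g p r) * signal \<rho> g' p s)
    = (\<Sum>u<n. overlap \<rho> (g u) (g' u) r s)"
proof -
  have eq: "blk (ftype \<rho>) * (n * fdim \<rho>) = n * cdim \<rho>"
    by (simp add: cdim_def)
  have "cdim \<rho> > 0"
    using is_frequencyD(4)[OF assms] blk_pos by (simp add: cdim_def)
  then show ?thesis
    unfolding eq sum_nat_blocks by (simp add: overlap_def signal_def)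
qed

text \<open>The part of the constant that depends on the frequency goes under the square as
  \<open>sqrt (beta (ftype \<rho>) * fdim \<rho>)\<close>. The remaining prefactor is common to all
  frequencies, whose contributions can then be merged into one squared norm.\<close>

lemma sum_mean_coord:
  assumes "is_frequency \<rho>" "n > 0"
  shows "(\<Sum>x\<in>noise_index n \<rho>. mean_coord n l \<rho> g x * mean_coord n l \<rho> g' x)
    = l\<^sup>2 / (2 * n) * (\<Sum>i<fdim \<rho>. \<Sum>j<fdim \<rho>. \<Sum>k<beta (ftype \<rho>).
        (\<Sum>u<n. sqrt (beta (ftype \<rho>) * fdim \<rho>) * coord (ftype \<rho>) (overlap \<rho> (g u) (g' u)) i j k)\<^sup>2)"
proof -
  define c where "c = l * sqrt (n * fdim \<rho>) / n"
  define K where "K = (\<Sum>i<fdim \<rho>. \<Sum>j<fdim \<rho>. \<Sum>k<beta (ftype \<rho>).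
        (\<Sum>u<n. coord (ftype \<rho>) (overlap \<rho> (g u) (g' u)) i j k)\<^sup>2)"
  have "(\<Sum>x\<in>noise_index n \<rho>. mean_coord n l \<rho> g x * mean_coord n l \<rho> g' x)
    = beta (ftype \<rho>) / 2 * c\<^sup>2 * K"
    unfolding noise_index_def mean_coord_def c_def K_def coord_sum[symmetric]
    by (subst sum_gcoord_gram[OF over_signal over_signal, OF assms(1) assms(1)])
       (simp only: sum_signal_mult_signal[OF assms(1)])
  also have "c\<^sup>2 = l\<^sup>2 * fdim \<rho> / n"
    using assms(2) by (simp add: c_def power_divide power_mult_distrib) (simp add: power2_eq_square)
  also have "beta (ftype \<rho>) / 2 * (l\<^sup>2 * fdim \<rho> / n) * K
    = l\<^sup>2 / (2 * n) * (real (beta (ftype \<rho>) * fdim \<rho>) * K)"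
    by simp
  also have "real (beta (ftype \<rho>) * fdim \<rho>) * K
    = (\<Sum>i<fdim \<rho>. \<Sum>j<fdim \<rho>. \<Sum>k<beta (ftype \<rho>).
        (\<Sum>u<n. sqrt (beta (ftype \<rho>) * fdim \<rho>) * coord (ftype \<rho>) (overlap \<rho> (g u) (g' u)) i j k)\<^sup>2)"
    unfolding K_def sum_distrib_left[symmetric] power_mult_distrib by simp
  finally show ?thesis .
qed

text \<open>The overlap is a unitary matrix of size
  \<open>cdim \<rho> = blk (ftype \<rho>) * fdim \<rho>\<close>, so its squared entries add up to
  this size, and they count every component \<open>blk (ftype \<rho>)\<close> times.\<close>

lemma sum_coord_overlap:
  assumes "is_frequency \<rho>"
  shows "(\<Sum>i<fdim \<rho>. \<Sum>j<fdim \<rho>. \<Sum>k<beta (ftype \<rho>). (coord (ftype \<rho>) (overlap \<rho> x y) i j k)\<^sup>2) = fdim \<rho>"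
proof -
  let ?c = "cdim \<rho>"
  note U = is_frequencyD(1)[OF assms]
  have row: "(\<Sum>s<?c. overlap \<rho> x y r s * cnj (overlap \<rho> x y r s)) = 1" if "r < ?c" for r
  proof -
    define a where "a p = cnj (frep \<rho> x $$ (p, r))" for p
    define S where "S p s = frep \<rho> y $$ (p, s)" for p s
    have "(\<Sum>s<?c. overlap \<rho> x y r s * cnj (overlap \<rho> x y r s))
      = (\<Sum>s<?c. \<Sum>p<?c. \<Sum>q<?c. (a p * S p s) * cnj (a q * S q s))"
      by (simp add: overlap_def a_def S_def sum_product)
    also have "\<dots> = (\<Sum>p<?c. \<Sum>s<?c. \<Sum>q<?c. (a p * S p s) * cnj (a q * S q s))"
      by (rule sum.swap)
    also have "\<dots> = (\<Sum>p<?c. \<Sum>q<?c. \<Sum>s<?c. (a p * S p s) * cnj (a q * S q s))"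
      by (intro sum.cong refl sum.swap)
    also have "\<dots> = (\<Sum>p<?c. \<Sum>q<?c. a p * cnj (a q) * (\<Sum>s<?c. S p s * cnj (S q s)))"
      by (simp add: sum_distrib_left mult_ac)
    \<comment> \<open>Orthonormality of the rows of \<open>frep \<rho> y\<close> leaves the terms
      with \<open>p = q\<close>; what remains is the norm of a column of
      \<open>frep \<rho> x\<close>.\<close>
    also have "\<dots> = (\<Sum>p<?c. a p * cnj (a p))"
      by (intro sum.cong refl) (simp add: S_def unitary_rep_rows[OF U] if_distrib cong: if_cong)
    also have "\<dots> = 1"
      using unitary_rep_cols[OF U that that, of x] by (simp add: a_def mult.commute)
    finally show ?thesis .
  qed
  have "(\<Sum>r<?c. \<Sum>s<?c. Re (overlap \<rho> x y r s * cnj (overlap \<rho> x y r s))) = ?c"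
    unfolding Re_sum[symmetric] by (simp add: row)
  then have "real (blk (ftype \<rho>)) * (\<Sum>i<fdim \<rho>. \<Sum>j<fdim \<rho>. \<Sum>k<beta (ftype \<rho>).
      (coord (ftype \<rho>) (overlap \<rho> x y) i j k)\<^sup>2) = real (blk (ftype \<rho>)) * fdim \<rho>"
    unfolding cdim_def sum_Re_mult_cnj[OF over_overlap over_overlap, OF assms assms]
    by (simp add: power2_eq_square)
  then show ?thesis
    using blk_pos[of "ftype \<rho>"] by simp
qed

lemma overlap_integrable:
  assumes "is_frequency \<rho>" "haar_probability \<mu>" "r < cdim \<rho>" "s < cdim \<rho>"
  shows "integrable \<mu> (\<lambda>y. overlap \<rho> x y r s)"
  unfolding overlap_def
  using unitary_rep_integrable[OF is_frequencyD(1)[OF assms(1)] assms(2)] assms(4) by auto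

text \<open>With \<open>x\<close> fixed, the overlap is a linear combination of entries of
  \<open>frep \<rho> y\<close>, all of mean zero.\<close>

lemma integral_overlap_eq_0:
  assumes "is_frequency \<rho>" "haar_probability \<mu>"
    and "\<not> isomorphic_reps (cdim \<rho>) (frep \<rho>) 1 (\<lambda>g. 1\<^sub>m 1)"
    and "r < cdim \<rho>" "s < cdim \<rho>"
  shows "(\<integral>y. overlap \<rho> x y r s \<partial>\<mu>) = 0"
  unfolding overlap_def
  using unitary_rep_integrable[OF is_frequencyD(1)[OF assms(1)] assms(2)] assms(5)
    integral_unitary_rep_eq_0[OF assms(2) is_frequencyD(1,2)[OF assms(1)] assms(3)]
  by (subst Bochner_Integration.integral_sum) auto

section \<open>Measurability, and the model as an image of standard Gaussians\<close>

lemma frep_component_measurable: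
  assumes "is_frequency \<rho>" "haar_probability \<mu>" "u < n" "p < cdim \<rho>" "q < cdim \<rho>"
  shows "(\<lambda>g. frep \<rho> (g u) $$ (p, q)) \<in> borel_measurable (PiM {..<n} (\<lambda>_. \<mu>))"
  by (rule measurable_compose[OF measurable_component_singleton[of u "{..<n}" "\<lambda>_. \<mu>"]
        unitary_rep_measurable[OF is_frequencyD(1)[OF assms(1)] assms(2,4,5)]])
     (use assms in auto)

lemma signal_measurable:
  assumes "is_frequency \<rho>" "haar_probability \<mu>" "p < n * cdim \<rho>" "r < cdim \<rho>"
  shows "(\<lambda>g. signal \<rho> g p r) \<in> borel_measurable (PiM {..<n} (\<lambda>_. \<mu>))"
  unfolding signal_def
  using assms by (intro frep_component_measurable) (auto simp: less_mult_imp_div_less)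

lemma gram_measurable:
  assumes "is_frequency \<rho>" "haar_probability \<mu>" "p < n * cdim \<rho>" "q < n * cdim \<rho>"
  shows "(\<lambda>g. \<Sum>r<cdim \<rho>. signal \<rho> g p r * cnj (signal \<rho> g q r)) \<in> borel_measurable (PiM {..<n} (\<lambda>_. \<mu>))"
proof (rule borel_measurable_sum)
  fix r assume "r \<in> {..<cdim \<rho>}"
  then have "(\<lambda>g. signal \<rho> g p r) \<in> borel_measurable (PiM {..<n} (\<lambda>_. \<mu>))"
    "(\<lambda>g. cnj (signal \<rho> g q r)) \<in> borel_measurable (PiM {..<n} (\<lambda>_. \<mu>))"
    using signal_measurable[OF assms(1,2)] assms(3,4)
    by (auto simp: borel_measurable_complex_iff)
  then show "(\<lambda>g. signal \<rho> g p r * cnj (signal \<rho> g q r)) \<in> borel_measurable (PiM {..<n} (\<lambda>_. \<mu>))"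
    by (rule borel_measurable_times)
qed

lemma mean_coord_measurable:
  assumes "is_frequency \<rho>" "haar_probability \<mu>" "x \<in> noise_index n \<rho>"
  shows "(\<lambda>g. mean_coord n l \<rho> g x) \<in> borel_measurable (PiM {..<n} (\<lambda>_. \<mu>))"
  unfolding mean_coord_def
  using assms gram_measurable[OF assms(1,2)]
  by (intro gcoord_measurable[where N="n * fdim \<rho>"] borel_measurable_times borel_measurable_const)
     (auto simp: noise_index_def cdim_def mult.left_commute)

lemma observation_measurable:
  assumes "is_frequency \<rho>" "haar_probability \<mu>"
    and f: "f \<in> M \<rightarrow>\<^sub>M PiM {..<n} (\<lambda>_. \<mu>)" and w: "w \<in> M \<rightarrow>\<^sub>M matrix_space (n * cdim \<rho>)"
  shows "(\<lambda>x. observation n l \<rho> (f x) (w x)) \<in> M \<rightarrow>\<^sub>M matrix_space (n * cdim \<rho>)"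
proof (rule measurable_matrix_space)
  have w': "w x \<in> carrier_mat (n * cdim \<rho>) (n * cdim \<rho>)" if "x \<in> space M" for x
    using measurable_space[OF w that] by (simp add: space_matrix_space)
  then show "observation n l \<rho> (f x) (w x) \<in> carrier_mat (n * cdim \<rho>) (n * cdim \<rho>)" if "x \<in> space M" for x
    using observation_carrier that by blast
  fix p q assume pq: "p < n * cdim \<rho>" "q < n * cdim \<rho>"
  have [measurable]: "(\<lambda>x. w x $$ (p, q)) \<in> borel_measurable M"
    by (rule measurable_compose[OF w matrix_space_index_measurable[OF pq]])
  have [measurable]: "(\<lambda>x. \<Sum>r<cdim \<rho>. signal \<rho> (f x) p r * cnj (signal \<rho> (f x) q r)) \<in> borel_measurable M"
    by (rule measurable_compose[OF f gram_measurable[OF assms(1,2) pq]])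
  have "(\<lambda>x. of_real (l / n) * (\<Sum>r<cdim \<rho>. signal \<rho> (f x) p r * cnj (signal \<rho> (f x) q r))
    + of_real (1 / sqrt (real (n * fdim \<rho>))) * w x $$ (p, q)) \<in> borel_measurable M"
    by measurable
  then show "(\<lambda>x. observation n l \<rho> (f x) (w x) $$ (p, q)) \<in> borel_measurable M"
    by (rule measurable_cong[THEN iffD1, rotated]) (simp add: observation_index[OF w' pq])
qed

lemma prob_space_haar: "haar_probability \<mu> \<Longrightarrow> prob_space \<mu>"
  by (simp add: haar_probability_def)

lemma matrix_space_eq: "matrix_space (blk (ftype \<rho>) * (n * fdim \<rho>)) = matrix_space (n * cdim \<rho>)"
  by (simp add: cdim_def mult.left_commute)

lemma hermitian_noise_measurable:
  "hermitian_of_gaussians (ftype \<rho>) (n * fdim \<rho>) \<in> PiM (noise_index n \<rho>) (\<lambda>_. \<gamma>) \<rightarrow>\<^sub>M matrix_space (n * cdim \<rho>)"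
  unfolding noise_index_def
  using hermitian_of_gaussians_measurable[of "ftype \<rho>" "n * fdim \<rho>"] by (simp only: matrix_space_eq)

lemma gaussian_ensemble_eq:
  "gaussian_ensemble (ftype \<rho>) (n * fdim \<rho>) = distr (PiM (noise_index n \<rho>) (\<lambda>_. \<gamma>))
     (matrix_space (n * cdim \<rho>)) (hermitian_of_gaussians (ftype \<rho>) (n * fdim \<rho>))"
  by (simp only: gaussian_ensemble_def noise_index_def matrix_space_eq)

lemma prob_space_noise_law: "prob_space (noise_law n \<Psi>)"
  unfolding noise_law_def by (intro prob_space_PiM prob_space_gamma_PiM)

lemma observations_measurable:
  assumes "\<And>\<rho>. \<rho> \<in> \<Psi> \<Longrightarrow> is_frequency \<rho>" and haar: "haar_probability \<mu>"
  shows "(\<lambda>(g, W). \<lambda>\<rho>\<in>\<Psi>. observation n (l \<rho>) \<rho> g (W \<rho>)) \<in>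
    PiM {..<n} (\<lambda>_. \<mu>) \<Otimes>\<^sub>M PiM \<Psi> (\<lambda>\<rho>. matrix_space (n * cdim \<rho>)) \<rightarrow>\<^sub>M PiM \<Psi> (\<lambda>\<rho>. matrix_space (n * cdim \<rho>))"
  unfolding case_prod_unfold
  by (intro measurable_restrict observation_measurable[OF _ haar] assms(1) measurable_fst
      measurable_compose[OF measurable_snd measurable_component_singleton])

text \<open>Each noise matrix is an image of independent Gaussians, and images commute with
  products. The model thus becomes the image of the hidden group elements and the Gaussians under a
  single map, whose measurability is the second claim.\<close>

lemma GSynch_eq:
  assumes "finite \<Psi>" "\<And>\<rho>. \<rho> \<in> \<Psi> \<Longrightarrow> is_frequency \<rho>" and haar: "haar_probability \<mu>"
  shows "GSynch n l \<mu> \<Psi> = distr (PiM {..<n} (\<lambda>_. \<mu>) \<Otimes>\<^sub>M noise_law n \<Psi>)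
    (PiM \<Psi> (\<lambda>\<rho>. matrix_space (n * cdim \<rho>)))
    (\<lambda>(g, z). \<lambda>\<rho>\<in>\<Psi>. observation n (l \<rho>) \<rho> g (hermitian_of_gaussians (ftype \<rho>) (n * fdim \<rho>) (z \<rho>)))"
    and "(\<lambda>(g, z). \<lambda>\<rho>\<in>\<Psi>. observation n (l \<rho>) \<rho> g (hermitian_of_gaussians (ftype \<rho>) (n * fdim \<rho>) (z \<rho>)))
      \<in> PiM {..<n} (\<lambda>_. \<mu>) \<Otimes>\<^sub>M noise_law n \<Psi> \<rightarrow>\<^sub>M PiM \<Psi> (\<lambda>\<rho>. matrix_space (n * cdim \<rho>))"
proof -
  let ?G = "PiM {..<n} (\<lambda>_. \<mu>)" and ?S = "PiM \<Psi> (\<lambda>\<rho>. matrix_space (n * cdim \<rho>))"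
  let ?H = "\<lambda>z. \<lambda>\<rho>\<in>\<Psi>. hermitian_of_gaussians (ftype \<rho>) (n * fdim \<rho>) (z \<rho>)"
  let ?F = "\<lambda>(g, W). \<lambda>\<rho>\<in>\<Psi>. observation n (l \<rho>) \<rho> g (W \<rho>)"
  have F: "?F \<in> ?G \<Otimes>\<^sub>M ?S \<rightarrow>\<^sub>M ?S"
    by (rule observations_measurable[OF assms(2,3)])
  have H: "?H \<in> noise_law n \<Psi> \<rightarrow>\<^sub>M ?S"
    unfolding noise_law_def
    by (intro measurable_restrict measurable_compose[OF _ hermitian_noise_measurable]
        measurable_component_singleton)
  have GH: "(\<lambda>(g, z). (g, ?H z)) \<in> ?G \<Otimes>\<^sub>M noise_law n \<Psi> \<rightarrow>\<^sub>M ?G \<Otimes>\<^sub>M ?S"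
    unfolding case_prod_unfold
    by (intro measurable_Pair measurable_fst measurable_compose[OF measurable_snd H])
  have eq: "(\<lambda>(g, z). \<lambda>\<rho>\<in>\<Psi>. observation n (l \<rho>) \<rho> g (hermitian_of_gaussians (ftype \<rho>) (n * fdim \<rho>) (z \<rho>)))
    = (\<lambda>x. ?F ((\<lambda>(g, z). (g, ?H z)) x))"
    by (auto simp: fun_eq_iff)
  show "(\<lambda>(g, z). \<lambda>\<rho>\<in>\<Psi>. observation n (l \<rho>) \<rho> g (hermitian_of_gaussians (ftype \<rho>) (n * fdim \<rho>) (z \<rho>)))
      \<in> ?G \<Otimes>\<^sub>M noise_law n \<Psi> \<rightarrow>\<^sub>M ?S"
    unfolding eq by (rule measurable_compose[OF GH F])
  have "prob_space (distr (noise_law n \<Psi>) ?S ?H)"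
    by (rule prob_space.prob_space_distr[OF prob_space_noise_law H])
  then have sf: "sigma_finite_measure (distr (noise_law n \<Psi>) ?S ?H)"
    by (rule prob_space_imp_sigma_finite)
  have "PiM \<Psi> (\<lambda>\<rho>. gaussian_ensemble (ftype \<rho>) (n * fdim \<rho>)) = distr (noise_law n \<Psi>) ?S ?H"
    unfolding gaussian_ensemble_eq noise_law_def
    by (rule distr_PiM_componentwise[symmetric])
       (use assms in \<open>simp_all add: prob_space_gamma_PiM hermitian_noise_measurable\<close>)
  then have "?G \<Otimes>\<^sub>M PiM \<Psi> (\<lambda>\<rho>. gaussian_ensemble (ftype \<rho>) (n * fdim \<rho>))
    = distr (?G \<Otimes>\<^sub>M noise_law n \<Psi>) (?G \<Otimes>\<^sub>M ?S) (\<lambda>(g, z). (g, ?H z))"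
    using pair_measure_distr[OF measurable_ident_sets[OF refl, of ?G] H sf] by simp
  then show "GSynch n l \<mu> \<Psi> = distr (?G \<Otimes>\<^sub>M noise_law n \<Psi>) ?S
    (\<lambda>(g, z). \<lambda>\<rho>\<in>\<Psi>. observation n (l \<rho>) \<rho> g (hermitian_of_gaussians (ftype \<rho>) (n * fdim \<rho>) (z \<rho>)))"
    unfolding GSynch_def eq by (simp add: distr_distr[OF F GH] comp_def)
qed

text \<open>For fixed \<open>g\<close> the exponent is \<open>l\<^sup>2 / (2 * n)\<close> times the
  squared norm of a sum of \<open>n\<close> independent centred vectors, so the sub-Gaussian bound
  applies with \<open>a = l\<^sup>2\<close>. The result depends on neither \<open>n\<close> nor
  \<open>g\<close>.\<close>

lemma second_moment_GSynch:
  fixes \<mu> :: "'g::{topological_group_add,t2_space} measure" and l :: real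
  assumes "finite \<Psi>" and freq: "\<And>\<rho>. \<rho> \<in> \<Psi> \<Longrightarrow> is_frequency \<rho>"
    and haar: "haar_probability \<mu>"
    and nontriv: "\<And>\<rho>. \<rho> \<in> \<Psi> \<Longrightarrow> \<not> isomorphic_reps (cdim \<rho>) (frep \<rho>) 1 (\<lambda>g. 1\<^sub>m 1)"
    and n: "n > 0"
  defines "D \<equiv> \<Sum>\<rho>\<in>\<Psi>. beta (ftype \<rho>) * (fdim \<rho>)\<^sup>2"
  assumes l: "l\<^sup>2 * D < 1"
  shows "(\<integral>\<^sup>+g'. exp (\<Sum>\<rho>\<in>\<Psi>. \<Sum>x\<in>noise_index n \<rho>. mean_coord n l \<rho> g x * mean_coord n l \<rho> g' x)
      \<partial>PiM {..<n} (\<lambda>_. \<mu>)) \<le> ennreal ((1 / sqrt (1 - l\<^sup>2 * D)) ^ D)"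
proof -
  \<comment> \<open>One index for each real component of each frequency, \<open>D\<close> in
    all.\<close>
  define I where "I = Sigma \<Psi> (\<lambda>\<rho>. {..<fdim \<rho>} \<times> {..<fdim \<rho>} \<times> {..<beta (ftype \<rho>)})"
  \<comment> \<open>The group element \<open>g u\<close> enters as a parameter; the argument
    \<open>y\<close> is the only random quantity.\<close>
  define v where "v = (\<lambda>u (\<rho>, i, j, k) y.
    sqrt (beta (ftype \<rho>) * fdim \<rho>) * coord (ftype \<rho>) (overlap \<rho> (g u) y) i j k)"
  have "finite I" using \<open>finite \<Psi>\<close> by (simp add: I_def)
  have card: "card I = D"
    using \<open>finite \<Psi>\<close> by (simp add: I_def D_def power2_eq_square mult_ac)
  have sum_I: "(\<Sum>x\<in>I. h x) = (\<Sum>\<rho>\<in>\<Psi>. \<Sum>i<fdim \<rho>. \<Sum>j<fdim \<rho>. \<Sum>k<beta (ftype \<rho>). h (\<rho>, i, j, k))"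
    for h :: "_ \<Rightarrow> real"
  proof -
    have "(\<Sum>x\<in>I. h x) = (\<Sum>\<rho>\<in>\<Psi>. \<Sum>y\<in>{..<fdim \<rho>} \<times> {..<fdim \<rho>} \<times> {..<beta (ftype \<rho>)}. h (\<rho>, y))"
      unfolding I_def using \<open>finite \<Psi>\<close> by (subst sum.Sigma) auto
    then show ?thesis by (simp add: sum.cartesian_product')
  qed
  have "(\<Sum>\<rho>\<in>\<Psi>. \<Sum>x\<in>noise_index n \<rho>. mean_coord n l \<rho> g x * mean_coord n l \<rho> g' x)
      = l\<^sup>2 / (2 * n) * (\<Sum>x\<in>I. (\<Sum>u<n. v u x (g' u))\<^sup>2)" for g'
    unfolding sum_I sum_distrib_left[of _ _ \<Psi>]
    by (intro sum.cong refl) (simp add: sum_mean_coord[OF freq n] v_def)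
  moreover have "(\<integral>\<^sup>+g'. exp (l\<^sup>2 / (2 * n) * (\<Sum>x\<in>I. (\<Sum>u<n. v u x (g' u))\<^sup>2)) \<partial>PiM {..<n} (\<lambda>_. \<mu>))
    \<le> ennreal ((1 / sqrt (1 - l\<^sup>2 * D)) ^ card I)"
  proof (rule nn_integral_exp_norm_sum_le[OF prob_space_haar[OF haar] \<open>finite I\<close>])
    fix u x assume "x \<in> I"
    then obtain \<rho> i j k where x: "x = (\<rho>, i, j, k)" and \<rho>: "\<rho> \<in> \<Psi>"
      and ijk: "i < fdim \<rho>" "j < fdim \<rho>" "k < beta (ftype \<rho>)"
      by (auto simp: I_def)
    note int = overlap_integrable[OF freq[OF \<rho>] haar, unfolded cdim_def]
    have "(\<lambda>y. coord (ftype \<rho>) (overlap \<rho> (g u) y) i j k) \<in> borel_measurable \<mu>"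
      by (rule coord_measurable[OF _ ijk]) (use int in auto)
    then show "v u x \<in> borel_measurable \<mu>"
      by (simp add: v_def x)
    have "(\<integral>y. coord (ftype \<rho>) (overlap \<rho> (g u) y) i j k \<partial>\<mu>) = 0"
      by (rule integral_coord_eq_0[OF int _ ijk])
         (use integral_overlap_eq_0[OF freq[OF \<rho>] haar nontriv[OF \<rho>]] in \<open>auto simp: cdim_def\<close>)
    then show "(\<integral>y. v u x y \<partial>\<mu>) = 0"
      by (simp add: v_def x)
  next
    fix u y
    \<comment> \<open>The squared length is exactly \<open>D\<close>, the same number as the
      dimension \<open>card I\<close>.\<close>
    have "(\<Sum>x\<in>I. (v u x y)\<^sup>2) = (\<Sum>\<rho>\<in>\<Psi>. real (beta (ftype \<rho>) * fdim \<rho>) * fdim \<rho>)"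
      unfolding sum_I v_def
    proof (intro sum.cong refl, goal_cases)
      case (1 \<rho>)
      show ?case
        by (simp add: power_mult_distrib sum_coord_overlap[OF freq[OF 1]] flip: sum_distrib_left)
    qed
    also have "\<dots> = D"
      by (simp add: D_def power2_eq_square mult.assoc)
    finally show "(\<Sum>x\<in>I. (v u x y)\<^sup>2) \<le> D" by simp
  qed (use n l in auto)
  ultimately show ?thesis
    by (simp only: card)
qed

section \<open>From the uniform second moment bound to contiguity\<close>

theorem theorem6p14:
  fixes \<mu> :: "'g::{topological_group_add,t2_space} measure"
    and \<Psi> :: "'g frequency set"
    and lam :: real
  assumes "compact (UNIV :: 'g set)"
    and "haar_probability \<mu>"
    and "list_of_frequencies \<Psi>"
    and "\<Psi> \<noteq> {}"
    and "0 \<le> lam"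
    and "lam < 1 / sqrt (\<Sum>\<rho>\<in>\<Psi>. real (beta (ftype \<rho>)) * (real (fdim \<rho>))\<^sup>2)"
  shows "contiguous (\<lambda>n. GSynch n (\<lambda>_. lam) \<mu> \<Psi>) (\<lambda>n. GSynch n (\<lambda>_. 0) \<mu> \<Psi>)"
proof -
  note haar = assms(2)
  have fin: "finite \<Psi>" and freq: "\<And>\<rho>. \<rho> \<in> \<Psi> \<Longrightarrow> is_frequency \<rho>"
    and nontriv: "\<And>\<rho>. \<rho> \<in> \<Psi> \<Longrightarrow> \<not> isomorphic_reps (cdim \<rho>) (frep \<rho>) 1 (\<lambda>g. 1\<^sub>m 1)"
    using assms(3) by (auto simp: list_of_frequencies_def)
  define D :: nat where "D = (\<Sum>\<rho>\<in>\<Psi>. beta (ftype \<rho>) * (fdim \<rho>)\<^sup>2)"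
  have "beta (ftype \<rho>) * (fdim \<rho>)\<^sup>2 > 0" if "\<rho> \<in> \<Psi>" for \<rho>
    using beta_pos is_frequencyD(4)[OF freq[OF that]] by simp
  \<comment> \<open>As \<open>\<Psi>\<close> is nonempty, the threshold \<open>1 / sqrt D\<close> is
    a genuine quotient and its denominator can be cleared.\<close>
  then have "D > 0"
    unfolding D_def using fin assms(4) by (intro sum_pos) auto
  have "lam < 1 / sqrt D"
    using assms(6) by (simp add: D_def)
  then have "lam * sqrt D < 1"
    using \<open>D > 0\<close> by (simp add: field_simps)
  then have "(lam * sqrt D)\<^sup>2 < 1"
    using assms(5) by (intro power_less_one_iff[THEN iffD2]) auto
  then have lD: "lam\<^sup>2 * D < 1"
    by (simp add: power_mult_distrib)
  \<comment> \<open>The second moment bound, free of \<open>n\<close>.\<close>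
  define C where "C = (1 / sqrt (1 - lam\<^sup>2 * D)) ^ D"
  have "C \<ge> 0" using lD by (simp add: C_def)
  show ?thesis
  proof (rule contiguousI_second_moment[OF _ _ _ _ \<open>C \<ge> 0\<close>])
    have pair: "prob_space (PiM {..<n} (\<lambda>_. \<mu>) \<Otimes>\<^sub>M noise_law n \<Psi>)" for n
    proof -
      interpret pair_prob_space "PiM {..<n} (\<lambda>_. \<mu>)" "noise_law n \<Psi>"
        unfolding pair_prob_space_def pair_sigma_finite_def
        by (intro conjI prob_space_imp_sigma_finite prob_space_noise_law prob_space_PiM prob_space_haar haar)
      show ?thesis by unfold_locales
    qed
    have prob: "prob_space (GSynch n l \<mu> \<Psi>)" for n l
      using prob_space.prob_space_distr[OF pair GSynch_eq(2)[OF fin freq haar]]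
      by (simp add: GSynch_eq(1)[OF fin freq haar])
    show "prob_space (GSynch n (\<lambda>_. lam) \<mu> \<Psi>)" "prob_space (GSynch n (\<lambda>_. 0) \<mu> \<Psi>)" for n
      by (rule prob)+
    show "sets (GSynch n (\<lambda>_. lam) \<mu> \<Psi>) = sets (GSynch n (\<lambda>_. 0) \<mu> \<Psi>)" for n
      by (simp add: GSynch_def)
  next
    fix n :: nat and A assume n: "n > 0" and A': "A \<in> sets (GSynch n (\<lambda>_. 0) \<mu> \<Psi>)"
    define G where "G = PiM {..<n} (\<lambda>_. \<mu>)"
    define Z where "Z = noise_law n \<Psi>"
    define S where "S = PiM \<Psi> (\<lambda>\<rho>. matrix_space (n * cdim \<rho>))"
    define F where "F = (\<lambda>l g z. \<lambda>\<rho>\<in>\<Psi>. observation n l \<rho> g (hermitian_of_gaussians (ftype \<rho>) (n * fdim \<rho>) (z \<rho>)))"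
    \<comment> \<open>The translation of the Gaussians by the signal; \<open>f\<close> below is its
      likelihood ratio.\<close>
    define T where "T = (\<lambda>g z. \<lambda>\<rho>\<in>\<Psi>. \<lambda>x\<in>noise_index n \<rho>. z \<rho> x + mean_coord n lam \<rho> g x)"
    define f where "f = (\<lambda>g z. \<Prod>\<rho>\<in>\<Psi>. \<Prod>x\<in>noise_index n \<rho>.
      ennreal (shift_density (mean_coord n lam \<rho> g x) (z \<rho> x)))"
    have A: "A \<in> sets S"
      using A' by (simp add: GSynch_def S_def)
    have GS: "GSynch n (\<lambda>_. l) \<mu> \<Psi> = distr (G \<Otimes>\<^sub>M Z) S (\<lambda>(g, z). F l g z)" for l
      unfolding G_def Z_def S_def F_def by (rule GSynch_eq(1)[OF fin freq haar])
    have F: "(\<lambda>(g, z). F l g z) \<in> G \<Otimes>\<^sub>M Z \<rightarrow>\<^sub>M S" for l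
      unfolding G_def Z_def S_def F_def by (rule GSynch_eq(2)[OF fin freq haar])
    interpret G: prob_space G
      unfolding G_def by (intro prob_space_PiM prob_space_haar haar)
    interpret Z: prob_space Z
      unfolding Z_def by (rule prob_space_noise_law)
    have fin_index: "finite (noise_index n \<rho>)" for \<rho>
      by (simp add: noise_index_def)
    \<comment> \<open>Any sample will do: at signal strength 0 the observation ignores
      \<open>g\<close>, so \<open>F 0 g0\<close> serves as the common map \<open>K\<close>.\<close>
    obtain g0 where g0: "g0 \<in> space G"
      using G.not_empty by blast
    define K where "K = F 0 g0"
    have K: "K \<in> Z \<rightarrow>\<^sub>M S"
      using measurable_Pair2[OF F g0] by (simp add: K_def)
    have F0: "F 0 g z = K z" for g z
      unfolding F_def K_def
      by (intro restrict_ext observation_0 hermitian_of_gaussians_carrier)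
    have FT: "F lam g z = K (T g z)" for g z
      unfolding F_def K_def T_def
    proof (rule restrict_ext)
      fix \<rho> assume "\<rho> \<in> \<Psi>"
      then show "observation n lam \<rho> g (hermitian_of_gaussians (ftype \<rho>) (n * fdim \<rho>) (z \<rho>))
        = observation n 0 \<rho> g0 (hermitian_of_gaussians (ftype \<rho>) (n * fdim \<rho>)
           ((\<lambda>\<rho>\<in>\<Psi>. \<lambda>x\<in>noise_index n \<rho>. z \<rho> x + mean_coord n lam \<rho> g x) \<rho>))"
        using observation_eq_shift[OF freq[OF \<open>\<rho> \<in> \<Psi>\<close>] n] by simp
    qed
    have z: "(\<lambda>z. z \<rho> x) \<in> borel_measurable Z" if "\<rho> \<in> \<Psi>" "x \<in> noise_index n \<rho>" for \<rho> x
    proof -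
      have "(\<lambda>z. z \<rho>) \<in> Z \<rightarrow>\<^sub>M PiM (noise_index n \<rho>) (\<lambda>_. \<gamma>)"
        unfolding Z_def noise_law_def by (rule measurable_component_singleton[OF that(1)])
      from measurable_compose[OF this measurable_component_singleton[OF that(2), of "\<lambda>_. \<gamma>"]]
      show ?thesis by simp
    qed
    have T: "T g \<in> Z \<rightarrow>\<^sub>M Z" for g
    proof -
      have "T g \<in> Z \<rightarrow>\<^sub>M PiM \<Psi> (\<lambda>\<rho>. PiM (noise_index n \<rho>) (\<lambda>_. \<gamma>))"
        unfolding T_def
      proof (intro measurable_restrict)
        fix \<rho> x assume "\<rho> \<in> \<Psi>" "x \<in> noise_index n \<rho>"
        from z[OF this] show "(\<lambda>z. z \<rho> x + mean_coord n lam \<rho> g x) \<in> Z \<rightarrow>\<^sub>M \<gamma>"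
          by simp
      qed
      then show ?thesis by (simp add: Z_def noise_law_def)
    qed
    have f: "(\<lambda>(g, z). f g z) \<in> borel_measurable (G \<Otimes>\<^sub>M Z)"
      unfolding f_def case_prod_unfold
    proof (intro borel_measurable_prod_ennreal measurable_compose[OF _ measurable_ennreal] shift_density_measurable)
      fix \<rho> x assume \<rho>: "\<rho> \<in> \<Psi>" and x: "x \<in> noise_index n \<rho>"
      show "(\<lambda>p. mean_coord n lam \<rho> (fst p) x) \<in> borel_measurable (G \<Otimes>\<^sub>M Z)"
        unfolding G_def
        by (rule measurable_compose[OF measurable_fst mean_coord_measurable[OF freq[OF \<rho>] haar x]])
      show "(\<lambda>p. snd p \<rho> x) \<in> borel_measurable (G \<Otimes>\<^sub>M Z)"
        by (rule measurable_compose[OF measurable_snd z[OF \<rho> x]])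
    qed
    have dens: "distr Z Z (T g) = density Z (f g)" for g
      unfolding Z_def noise_law_def T_def f_def
      by (rule distr_gamma_PiM_PiM_shift[OF fin fin_index])
    have inner: "(\<integral>\<^sup>+z. f g z * f g' z \<partial>Z) = exp (\<Sum>\<rho>\<in>\<Psi>. \<Sum>x\<in>noise_index n \<rho>.
        mean_coord n lam \<rho> g x * mean_coord n lam \<rho> g' x)" for g g'
      unfolding Z_def noise_law_def f_def
      by (rule nn_integral_PiM_PiM_shift_density_mult[OF fin fin_index])
    \<comment> \<open>The inner double integral is bounded for every \<open>g\<close>; averaging
      over the probability measure \<open>G\<close> keeps the bound.\<close>
    have "(\<integral>\<^sup>+g. \<integral>\<^sup>+g'. \<integral>\<^sup>+z. f g z * f g' z \<partial>Z \<partial>G \<partial>G) \<le> (\<integral>\<^sup>+g. ennreal C \<partial>G)"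
      unfolding inner unfolding G_def C_def D_def
      by (intro nn_integral_mono second_moment_GSynch[OF fin freq haar nontriv n]) (use lD D_def in auto)
    also have "\<dots> = C"
      by (simp add: G.emeasure_space_1)
    finally have C: "(\<integral>\<^sup>+g. \<integral>\<^sup>+g'. \<integral>\<^sup>+z. f g z * f g' z \<partial>Z \<partial>G \<partial>G) \<le> C" .
    \<comment> \<open>As \<open>F 0\<close> ignores \<open>g\<close>, preimages of events are
      cylinders over all of \<open>G\<close>, so the null model is the image of the noise
      alone.\<close>
    have Q: "emeasure (distr Z S K) A = emeasure (GSynch n (\<lambda>_. 0) \<mu> \<Psi>) A"
    proof -
      have "(\<lambda>(g, z). F 0 g z) -` A \<inter> space (G \<Otimes>\<^sub>M Z) = space G \<times> (K -` A \<inter> space Z)"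
        by (auto simp: F0 space_pair_measure)
      then show ?thesis
        using A F[of 0] K
        by (simp add: GS emeasure_distr Z.emeasure_pair_measure_Times G.emeasure_space_1)
    qed
    have "(emeasure (GSynch n (\<lambda>_. lam) \<mu> \<Psi>) A)\<^sup>2
      \<le> (\<integral>\<^sup>+g. \<integral>\<^sup>+g'. \<integral>\<^sup>+z. f g z * f g' z \<partial>Z \<partial>G \<partial>G) * emeasure (distr Z S K) A"
      unfolding GS
      by (rule emeasure_distr_le_second_moment[OF G.prob_space_axioms Z.prob_space_axioms K F T FT f dens A])
    also have "\<dots> \<le> ennreal C * emeasure (GSynch n (\<lambda>_. 0) \<mu> \<Psi>) A"
      unfolding Q by (intro mult_right_mono C) simp
    finally show "(emeasure (GSynch n (\<lambda>_. lam) \<mu> \<Psi>) A)\<^sup>2 \<le> ennreal C * emeasure (GSynch n (\<lambda>_. 0) \<mu> \<Psi>) A" .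
  qed
qed

end
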